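(* Let $k$ be a field of characteristic $p>0$ and let $f,g\in k[[t]]$ be two algebraic univariate power series of degree $d$ and $d'$ and height $h$ and $h'$, respectively. Set $$N:=(d+1)(d'+1)(h+1)(h'+1).$$ Then the Lamperti product $f\circ_{\mathrm L}g$ (for any parameters $\alpha,\beta,\gamma\in k$) is an algebraic power series of degree at most $p^N-1$ over $k(t)$. In particular, the same result holds for the Hadamard product $f\odot g$ and the Hurwitz product $f\circ_{\mathrm H}g$.
   Context: A power series in $k[[t]]$ is algebraic if it is algebraic over $k(t)$. The degree of $f$ is $[k(t)(f):k(t)]$ and its height is the minimal degree in $t$ of a nonzero polynomial $A(t,y)\in k[t,y]$ with $A(t,f)=0$. For $f=\sum_{i\ge0}a(i)t^i$ and $g=\sum_{i\ge0}b(i)t^i$ in $k[[t]]$: Hadamard product: $f\odot g=\sum_{i\ge0}a(i)b(i)t^i$. Hurwitz product: $f\circ_{\mathrm H}g=\sum_{i\ge0}\Big(\sum_{m=0}^{i}\binom{i}{m}a(m)b(i-m)\Big)t^i$. Lamperti product with parameters $\alpha,\beta,\gamma\in k$: $f\circ_{\mathrm L}g=\sum_{i\ge0}\Big(\sum_{j+m+\ell=i}\frac{i!}{j!\,m!\,\ell!}\,\alpha^j\beta^m\gamma^\ell\,a(j+m)\,b(\ell+m)\Big)t^i$, where $j,m,\ell$ range over nonnegative integers, the multinomial coefficients are integers viewed in $k$, and $0^0=1$. *)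

theory Defs
  imports
    "HOL-Computational_Algebra.Computational_Algebra"
    "HOL-Algebra.Finite_Extensions"
    "HOL-Algebra.Generated_Fields"
    "HOL-Algebra.Algebraic_Closure_Type"
begin

text \<open>
  Everything takes place inside the field \<open>k((t))\<close> of formal Laurent series, which contains
  \<open>k[[t]]\<close> via \<^const>\<open>fps_to_fls\<close>; as a record it is
  \<open>ring_of_type_algebra\<close>, so that the field-extension notions of HOL-Algebra apply.
\<close>

abbreviation laurent_ring :: "'k::field fls ring" where
  "laurent_ring \<equiv> ring_of_type_algebra"

definition rational_functions :: "'k::field fls set" where
  "rational_functions =
     {fps_to_fls (fps_of_poly a) / fps_to_fls (fps_of_poly b) | a b. b \<noteq> 0}"

definition algebraic_series :: "'k::field fps \<Rightarrow> bool" where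
  "algebraic_series f \<longleftrightarrow>
     (ring.algebraic laurent_ring over rational_functions) (fps_to_fls f)"

definition series_field :: "'k::field fps \<Rightarrow> 'k fls set" where
  "series_field f =
     generate_field laurent_ring (insert (fps_to_fls f) rational_functions)"

text \<open>The value is unspecified if the extension is infinite, i.e. if \<open>f\<close> is transcendental.\<close>

definition series_degree :: "'k::field fps \<Rightarrow> nat" where
  "series_degree f = (ring.dim laurent_ring over rational_functions) (series_field f)"

text \<open>
  A polynomial \<open>A(t,y) \<in> k[t,y]\<close> is represented as an element of \<open>(k[t])[y]\<close>: the outer
  indeterminate is \<open>y\<close> and the coefficients are polynomials in \<open>t\<close>.
\<close>

definition t_degree :: "'k::field poly poly \<Rightarrow> nat" where
  "t_degree A = (MAX i\<in>{..Polynomial.degree A}. Polynomial.degree (Polynomial.coeff A i))"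

definition eval_series :: "'k::field poly poly \<Rightarrow> 'k fps \<Rightarrow> 'k fps" where
  "eval_series A f = poly (map_poly fps_of_poly A) f"

text \<open>Unspecified if \<open>f\<close> is transcendental.\<close>

definition series_height :: "'k::field fps \<Rightarrow> nat" where
  "series_height f = (LEAST n. \<exists>A. A \<noteq> 0 \<and> eval_series A f = 0 \<and> t_degree A = n)"

definition hadamard_product :: "'k::field fps \<Rightarrow> 'k fps \<Rightarrow> 'k fps" where
  "hadamard_product f g = Abs_fps (\<lambda>i. fps_nth f i * fps_nth g i)"

definition hurwitz_product :: "'k::field fps \<Rightarrow> 'k fps \<Rightarrow> 'k fps" where
  "hurwitz_product f g =
     Abs_fps (\<lambda>i. \<Sum>m=0..i. of_nat (i choose m) * fps_nth f m * fps_nth g (i - m))"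

text \<open>
  The multinomial coefficient is computed in the natural numbers, where the division is exact,
  and only then mapped to \<open>k\<close>; in \<open>k\<close> the factorials may vanish.
\<close>

definition lamperti_product ::
    "'k::field \<Rightarrow> 'k \<Rightarrow> 'k \<Rightarrow> 'k fps \<Rightarrow> 'k fps \<Rightarrow> 'k fps" where
  "lamperti_product \<alpha> \<beta> \<gamma> f g =
     Abs_fps (\<lambda>i. \<Sum>(j, m, l) \<in> {(j, m, l). j + m + l = i}.
       of_nat (fact i div (fact j * fact m * fact l)) * \<alpha> ^ j * \<beta> ^ m * \<gamma> ^ l
         * fps_nth f (j + m) * fps_nth g (l + m))"

end

theory Submission
  imports Defs
begin

text \<open>
  Let \<open>E(t,y)\<close> be a separable annihilator of \<open>f\<close> of \<open>y\<close>-degree at most \<open>d\<close> and \<open>t\<close>-degree at most \<open>h\<close>.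
  Applying the Cartier operator to \<open>P E^{p-1} / E^p\<close> at the simple root \<open>y = f\<close> shows that each of the
  \<open>(d+1)(h+1)\<close> elements \<open>t^a f^b / E_y(f)\<close> is a \<open>k[t]\<close>-combination, with coefficients of degree less than
  \<open>p\<close>, of the \<open>p\<close>-th powers of these elements; \<open>f\<close> lies in their \<open>k\<close>-span. Working with \<open>p\<close>-th powers
  rather than \<open>p\<close>-th roots avoids any perfectness assumption. For \<open>a, b < p\<close> the Lamperti
  product of \<open>t^a u^p\<close> and \<open>t^b v^p\<close> is a polynomial times the \<open>p\<close>-th power of the product of \<open>u\<close> and \<open>v\<close>, so
  the products of the generators of \<open>f\<close> and \<open>g\<close> form a system of the same kind with \<open>N\<close> members.
  Iterating it, the \<open>N + 1\<close> series \<open>L^{p^j}\<close>, \<open>j \<le> N\<close>, lie in the \<open>k(t)\<close>-span of \<open>N\<close> elements,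
  and a linear relation between them yields an annihilator of \<open>L\<close> of degree at most \<open>p^N - 1\<close>.
\<close>

hide_const (open) Polynomials.degree

subsection \<open>Linear relations\<close>

text \<open>Fraction-free Gaussian elimination, by induction on the equations: rows are reduced by
  cross-multiplication instead of division. It is therefore available over \<open>k[t]\<close>
  itself, so the final relation has polynomial coefficients at once.\<close>

lemma linear_relation_exists:
  fixes b :: "'j \<Rightarrow> 'i \<Rightarrow> 'a::idom"
  assumes "finite I" and "finite J" and "card I < card J"
  shows "\<exists>c. (\<exists>j\<in>J. c j \<noteq> 0) \<and> (\<forall>i\<in>I. (\<Sum>j\<in>J. c j * b j i) = 0)"
  using assms
proof (induction I arbitrary: J b rule: finite_induct)
  case empty
  then have "\<exists>j. j \<in> J"
    by (metis card.empty equals0I less_irrefl)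
  then show ?case
    by (intro exI[of _ "\<lambda>_. 1"]) auto
next
  case (insert i I)
  show ?case
  proof (cases "\<forall>j\<in>J. b j i = 0")
    case True
    have "card I < card J"
      using insert by simp
    from insert.IH[OF insert.prems(1) this, of b]
    obtain c where "\<exists>j\<in>J. c j \<noteq> 0" "\<forall>k\<in>I. (\<Sum>j\<in>J. c j * b j k) = 0"
      by blast
    then show ?thesis
      using True by (intro exI[of _ c]) simp
  next
    case False
    then obtain j0 where j0: "j0 \<in> J" "b j0 i \<noteq> 0"
      by blast
    have "finite (J - {j0})" "card I < card (J - {j0})"
      using insert j0 by auto
    from insert.IH[OF this, of "\<lambda>j k. b j0 i * b j k - b j i * b j0 k"]
    obtain c j1 where j1: "j1 \<in> J - {j0}" "c j1 \<noteq> 0"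
      and c: "\<forall>k\<in>I. (\<Sum>j\<in>J - {j0}. c j * (b j0 i * b j k - b j i * b j0 k)) = 0"
      by blast
    \<comment> \<open>A relation among the reduced rows lifts to the original rows after scaling by
      the pivot \<open>b j0 i\<close>; the coefficient at \<open>j0\<close> gathers the multiples of
      row \<open>j0\<close> that were subtracted. Equation \<open>i\<close> then holds because every
      reduced row vanishes at \<open>i\<close>.\<close>
    define c' where "c' j = (if j = j0 then - (\<Sum>j\<in>J - {j0}. c j * b j i) else b j0 i * c j)" for j
    have *: "(\<Sum>j\<in>J. c' j * b j k) = (\<Sum>j\<in>J - {j0}. c j * (b j0 i * b j k - b j i * b j0 k))" for k
    proof -
      have "(\<Sum>j\<in>J. c' j * b j k) = c' j0 * b j0 k + (\<Sum>j\<in>J - {j0}. c' j * b j k)"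
        using insert.prems(1) j0 by (simp add: sum.remove)
      also have "(\<Sum>j\<in>J - {j0}. c' j * b j k) = (\<Sum>j\<in>J - {j0}. c j * (b j0 i * b j k))"
        by (intro sum.cong) (auto simp: c'_def)
      also have "c' j0 * b j0 k = - (\<Sum>j\<in>J - {j0}. c j * (b j i * b j0 k))"
        by (simp add: c'_def sum_distrib_right mult.assoc)
      finally show ?thesis
        by (simp add: right_diff_distrib sum_subtractf)
    qed
    have "(\<Sum>j\<in>J. c' j * b j k) = 0" if "k \<in> insert i I" for k
      using that c unfolding * by auto
    moreover have "c' j1 \<noteq> 0"
      using j1 j0 by (auto simp: c'_def)
    ultimately show ?thesis
      using j1 by blast
  qed
qed

text \<open>
  Gaussian elimination commutes with the embedding \<open>\<phi>\<close>, so linear dependence over the larger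
  field descends to the image of \<open>\<phi>\<close>.
\<close>

lemma linear_dependence_descends:
  fixes \<phi> :: "'k::field \<Rightarrow> 'l::field" and u :: "'j \<Rightarrow> 'n \<Rightarrow> 'k"
  assumes diff: "\<And>x y. \<phi> (x - y) = \<phi> x - \<phi> y" and mult: "\<And>x y. \<phi> (x * y) = \<phi> x * \<phi> y"
    and inj: "\<And>x. \<phi> x = 0 \<longleftrightarrow> x = 0"
    and "finite J" and "j0 \<in> J" and "c j0 \<noteq> 0"
    and "\<And>n. (\<Sum>j\<in>J. c j * \<phi> (u j n)) = 0"
  shows "\<exists>d. (\<exists>j\<in>J. d j \<noteq> 0) \<and> (\<forall>n. (\<Sum>j\<in>J. d j * u j n) = 0)"
  using assms(4-)
proof (induction J arbitrary: c u j0 rule: finite_induct)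
  case (insert i J)
  show ?case
  proof (cases "\<forall>n. u i n = 0")
    case True
    show ?thesis
      using insert.hyps by (intro exI[of _ "\<lambda>j. if j = i then 1 else 0"]) (auto simp: True intro!: sum.neutral)
  next
    case False
    then obtain m where m: "u i m \<noteq> 0"
      by blast
    define q where "q j = u j m / u i m" for j
    \<comment> \<open>\<open>e\<close> is what remains on row \<open>i\<close> once the multiples
      \<open>q j\<close> of it have been subtracted from the other rows. All reduced rows vanish in
      column \<open>m\<close>, which forces \<open>e = 0\<close>.\<close>
    define e where "e = c i + (\<Sum>j\<in>J. c j * \<phi> (q j))"
    have split: "(\<Sum>j\<in>J. c j * \<phi> (u j n - q j * u i n)) + e * \<phi> (u i n) = 0" for n
    proof -
      have "(\<Sum>j\<in>J. c j * \<phi> (u j n - q j * u i n)) =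
          (\<Sum>j\<in>J. c j * \<phi> (u j n)) - (\<Sum>j\<in>J. c j * \<phi> (q j)) * \<phi> (u i n)"
        by (simp only: diff mult right_diff_distrib sum_subtractf sum_distrib_right mult.assoc)
      moreover have "c i * \<phi> (u i n) + (\<Sum>j\<in>J. c j * \<phi> (u j n)) = 0"
        using insert.prems(3)[of n] insert.hyps by simp
      ultimately show ?thesis
        by (simp add: e_def distrib_right add.commute)
    qed
    have zero: "\<phi> 0 = 0"
      by (simp add: inj)
    have "\<phi> (u j m - q j * u i m) = 0" for j
      using m by (simp add: q_def zero)
    then have "e * \<phi> (u i m) = 0"
      using split[of m] by (simp only: mult_zero_right sum.neutral_const add_0_left)
    then have e: "e = 0"
      using m inj by auto
    have "\<exists>j\<in>J. c j \<noteq> 0"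
    proof (rule ccontr)
      assume "\<not> ?thesis"
      then have "c i = 0" "j0 = i"
        using e insert.prems(1,2) by (auto simp: e_def)
      then show False
        using insert.prems(2) by simp
    qed
    then obtain j1 where j1: "j1 \<in> J" "c j1 \<noteq> 0"
      by blast
    have "\<And>n. (\<Sum>j\<in>J. c j * \<phi> (u j n - q j * u i n)) = 0"
      using split e by simp
    from insert.IH[where u = "\<lambda>j n. u j n - q j * u i n", OF j1 this] obtain d j2 where
      d: "j2 \<in> J" "d j2 \<noteq> 0" "\<And>n. (\<Sum>j\<in>J. d j * (u j n - q j * u i n)) = 0"
      by blast
    define d' where "d' j = (if j = i then - (\<Sum>j\<in>J. d j * q j) else d j)" for j
    have "(\<Sum>j\<in>insert i J. d' j * u j n) = (\<Sum>j\<in>J. d j * (u j n - q j * u i n))" for n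
    proof -
      have "(\<Sum>j\<in>J. d' j * u j n) = (\<Sum>j\<in>J. d j * u j n)"
        using insert.hyps by (auto simp: d'_def intro!: sum.cong)
      moreover have "d' i * u i n = - (\<Sum>j\<in>J. d j * (q j * u i n))"
        by (simp add: d'_def sum_distrib_right mult.assoc)
      ultimately show ?thesis
        using insert.hyps by (simp add: right_diff_distrib sum_subtractf)
    qed
    then have "\<forall>n. (\<Sum>j\<in>insert i J. d' j * u j n) = 0"
      using d(3) by simp
    moreover have "d' j2 \<noteq> 0"
      using d insert.hyps by (auto simp: d'_def)
    ultimately show ?thesis
      using d(1) by blast
  qed
qed simp

lemma frobenius_diff:
  fixes x y :: "'a::comm_ring_1"
  assumes "prime p" and "p = CHAR('a)"
  shows "(x - y) ^ p = x ^ p - y ^ p"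
  using freshmans_dream[of p "x - y" y] assms by (simp add: algebra_simps)

subsection \<open>Annihilating polynomials\<close>

lemma eval_series_0 [simp]: "eval_series 0 f = 0"
  by (simp add: eval_series_def)

lemma eval_series_pCons [simp]:
  "eval_series (pCons a A) f = fps_of_poly a + f * eval_series A f"
  by (simp add: eval_series_def map_poly_pCons)

lemma eval_series_add [simp]: "eval_series (A + B) f = eval_series A f + eval_series B f"
  by (induction A B rule: poly_induct2) (simp_all add: fps_of_poly_add algebra_simps)

lemma eval_series_smult [simp]: "eval_series (smult a A) f = fps_of_poly a * eval_series A f"
  by (induction A) (simp_all add: fps_of_poly_mult algebra_simps)

lemma eval_series_mult [simp]: "eval_series (A * B) f = eval_series A f * eval_series B f"
  by (induction A) (simp_all add: algebra_simps)

lemma eval_series_sum: "eval_series (sum A S) f = (\<Sum>i\<in>S. eval_series (A i) f)"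
  by (induction S rule: infinite_finite_induct) simp_all

lemma eval_series_monom: "eval_series (Polynomial.monom a n) f = fps_of_poly a * f ^ n"
  by (induction n) (simp_all add: monom_0 monom_Suc algebra_simps)

lemma eval_series_altdef: "eval_series A f = (\<Sum>i\<le>degree A. fps_of_poly (coeff A i) * f ^ i)"
  by (subst (1) poly_as_sum_of_monoms[symmetric]) (simp add: eval_series_sum eval_series_monom)

section \<open>Degrees in \<open>t\<close>, Gauss's lemma and minimal annihilators\<close>

lemma degree_coeff_le_t_degree: "degree (coeff A i) \<le> t_degree A"
proof (cases "i \<le> degree A")
  case True
  then show ?thesis
    unfolding t_degree_def by (intro Max_ge) auto
qed (simp add: coeff_eq_0)

lemma coeff_mult_bound:
  fixes q r :: "'a::comm_semiring_0 poly"
  assumes "degree q \<le> a" and "degree r \<le> b"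
  shows "coeff (q * r) (a + b) = coeff q a * coeff r b"
proof (cases "degree q = a \<and> degree r = b")
  case True
  then show ?thesis
    using coeff_mult_degree_sum[of q r] by auto
next
  case False
  then have "degree q + degree r < a + b" and "degree q < a \<or> degree r < b"
    using assms by auto
  then have "degree (q * r) < a + b"
    using degree_mult_le[of q r] by linarith
  then show ?thesis
    using \<open>degree q < a \<or> degree r < b\<close> by (auto simp: coeff_eq_0)
qed

text \<open>The coefficients of the highest power of \<open>t\<close> form a nonzero polynomial in
  \<open>y\<close>, and two such polynomials have a nonzero product. Hence degrees in
  \<open>t\<close> add up under multiplication, and a factor inherits the bound.\<close>

lemma degree_coeff_factor_le:
  fixes Q M :: "'a::field poly poly"
  assumes "Q * M \<noteq> 0" and bound: "\<And>i. degree (coeff (Q * M) i) \<le> h"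
  shows "degree (coeff M i) \<le> h"
proof -
  define top where "top a A = map_poly (\<lambda>q. coeff q a) A" for a and A :: "'a poly poly"
  have attained: "top (t_degree A) A \<noteq> 0" if "A \<noteq> 0" for A :: "'a poly poly"
  proof -
    have "t_degree A \<in> (\<lambda>i. degree (coeff A i)) ` {..degree A}"
      unfolding t_degree_def by (intro Max_in) auto
    then obtain i where i: "t_degree A = degree (coeff A i)"
      by auto
    show ?thesis
    proof (cases "coeff A i = 0")
      \<comment> \<open>The zero polynomial has degree 0, so the maximum may be attained at a
        vanishing coefficient. Then all coefficients are constants and the leading one serves
        instead.\<close>
      case True
      then have "degree (coeff A (degree A)) = 0"
        using degree_coeff_le_t_degree[of A "degree A"] i by simp
      then have "coeff (top (t_degree A) A) (degree A) \<noteq> 0"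
        using that True i by (simp add: top_def coeff_map_poly)
          (metis degree_0_id coeff_pCons_0 leading_coeff_0_iff)
      then show ?thesis
        by auto
    next
      case False
      then have "coeff (top (t_degree A) A) i \<noteq> 0"
        by (simp add: top_def coeff_map_poly i)
      then show ?thesis
        by auto
    qed
  qed
  let ?a = "t_degree Q" and ?b = "t_degree M"
  have "top (?a + ?b) (Q * M) = top ?a Q * top ?b M"
  proof (rule poly_eqI)
    fix n
    show "coeff (top (?a + ?b) (Q * M)) n = coeff (top ?a Q * top ?b M) n"
      by (simp add: top_def coeff_map_poly coeff_mult[of Q M] coeff_mult[of "top ?a Q"]
          coeff_mult[of "map_poly _ _"] coeff_sum coeff_mult_bound degree_coeff_le_t_degree)
  qed
  moreover have "top ?a Q * top ?b M \<noteq> 0"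
    using attained assms by auto
  ultimately obtain n where "coeff (top (?a + ?b) (Q * M)) n \<noteq> 0"
    by (metis leading_coeff_0_iff)
  then have "?a + ?b \<le> degree (coeff (Q * M) n)"
    by (intro le_degree) (simp add: top_def coeff_map_poly)
  then show ?thesis
    using bound[of n] degree_coeff_le_t_degree[of M i] by linarith
qed

lemma prime_factor_exists_field_poly:
  fixes c :: "'k::field poly"
  assumes "degree c > 0"
  obtains \<pi> where "prime_elem \<pi>" and "\<pi> dvd c"
proof -
  obtain \<pi> where \<pi>: "\<pi> dvd c" "degree \<pi> > 0"
    and least: "\<And>\<rho>. \<rho> dvd c \<Longrightarrow> degree \<rho> > 0 \<Longrightarrow> degree \<pi> \<le> degree \<rho>"
    using ex_has_least_nat[of "\<lambda>\<rho>. \<rho> dvd c \<and> degree \<rho> > 0" c degree] assms by auto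
  have "\<pi> \<noteq> 0"
    using \<pi> by auto
  have "irreducible \<pi>"
  proof (rule irreducibleI)
    show "\<pi> \<noteq> 0" "\<not> \<pi> dvd 1"
      using \<pi> \<open>\<pi> \<noteq> 0\<close> by (auto simp: is_unit_iff_degree)
    fix a b assume ab: "\<pi> = a * b"
    then have "a \<noteq> 0" "b \<noteq> 0" "a dvd c"
      using \<pi> by (auto intro: dvd_trans)
    then show "a dvd 1 \<or> b dvd 1"
      using least[of a] degree_mult_eq[of a b] ab
      by (cases "degree a = 0") (auto simp: is_unit_iff_degree)
  qed
  then show ?thesis
    using that \<pi> field_poly_irreducible_imp_prime by blast
qed

text \<open>Gauss's lemma: the hypothesis is divisibility over \<open>k(t)\<close> with denominator
  \<open>c\<close>. A prime of \<open>k[t]\<close> stays prime in \<open>k[t][y]\<close>, so by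
  primitivity of \<open>M\<close> each prime factor of \<open>c\<close> divides \<open>Q\<close> and
  can be cancelled.\<close>

lemma gauss_divides:
  fixes A Q M :: "'k::field poly poly"
  assumes primitive: "\<And>\<pi>. prime_elem \<pi> \<Longrightarrow> \<not> [:\<pi>:] dvd M"
    and "c \<noteq> 0" and "smult c A = Q * M"
  shows "M dvd A"
  using assms(2,3)
proof (induction "degree c" arbitrary: c Q rule: less_induct)
  case less
  show ?case
  proof (cases "degree c = 0")
    case True
    then have "c dvd 1"
      using less.prems by (simp add: is_unit_iff_degree)
    then obtain c' where "c * c' = 1"
      by (metis dvdE)
    then have "A = smult c' (smult c A)"
      by (simp add: mult.commute)
    then show ?thesis
      using less.prems by (metis dvd_triv_right mult_smult_left)
  next
    case False
    then obtain \<pi> where \<pi>: "prime_elem \<pi>" "\<pi> dvd c"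
      using prime_factor_exists_field_poly by blast
    then obtain c1 where c1: "c = \<pi> * c1"
      by (elim dvdE)
    have "[:\<pi>:] * smult c1 A = Q * M"
      using less.prems by (simp add: c1 mult.commute)
    then have "[:\<pi>:] dvd Q * M"
      by (metis dvd_triv_left)
    then have "[:\<pi>:] dvd Q"
      using primitive[OF \<pi>(1)] lift_prime_elem_poly[OF \<pi>(1)] prime_elem_dvd_mult_iff by blast
    then obtain Q1 where "Q = [:\<pi>:] * Q1"
      by (elim dvdE)
    then have "[:\<pi>:] * smult c1 A = [:\<pi>:] * (Q1 * M)"
      using \<open>[:\<pi>:] * smult c1 A = Q * M\<close> by (simp only: mult.assoc)
    moreover have "\<pi> \<noteq> 0" "\<not> \<pi> dvd 1" "c1 \<noteq> 0"
      using \<pi> c1 less.prems by (auto simp: prime_elem_def)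
    ultimately have "smult c1 A = Q1 * M" "degree c1 < degree c"
      by (metis mult_cancel_left pCons_eq_0_iff)
        (use \<open>\<pi> \<noteq> 0\<close> \<open>\<not> \<pi> dvd 1\<close> \<open>c1 \<noteq> 0\<close> in
          \<open>simp add: c1 degree_mult_eq is_unit_iff_degree\<close>)
    then show ?thesis
      using less.hyps \<open>c1 \<noteq> 0\<close> by blast
  qed
qed

text \<open>The height and the degree may be realised by different annihilators \<open>A\<close> and
  \<open>B\<close>. A primitive annihilator of least \<open>y\<close>-degree satisfies both bounds:
  it divides \<open>A\<close> by Gauss's lemma, and by minimality its degree is at most that of
  \<open>B\<close>.\<close>

lemma minimal_annihilator_exists:
  fixes f :: "'k::field fps"
  assumes A: "A \<noteq> 0" "eval_series A f = 0" and h: "\<And>i. degree (coeff A i) \<le> h"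
    and B: "B \<noteq> 0" "eval_series B f = 0" "degree B \<le> d"
  obtains M where "M \<noteq> 0" "eval_series M f = 0" "degree M \<le> d" "\<And>i. degree (coeff M i) \<le> h"
    "\<And>C. C \<noteq> 0 \<Longrightarrow> eval_series C f = 0 \<Longrightarrow> degree M \<le> degree C"
proof -
  define S where "S = {C. C \<noteq> 0 \<and> eval_series C f = 0}"
  have "B \<in> S"
    using B by (simp add: S_def)
  then obtain M0 where M0: "M0 \<in> S" and n_min: "\<And>C. C \<in> S \<Longrightarrow> degree M0 \<le> degree C"
    using ex_has_least_nat[of "\<lambda>C. C \<in> S" B degree] by blast
  define n where "n = degree M0"
  \<comment> \<open>The second minimisation secures primitivity: a prime dividing all coefficients
    could be divided out, lowering the degree of the leading coefficient.\<close>
  obtain M where M: "M \<in> S" "degree M = n"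
    and M_min: "\<And>C. C \<in> S \<Longrightarrow> degree C = n \<Longrightarrow> degree (lead_coeff M) \<le> degree (lead_coeff C)"
    using ex_has_least_nat[of "\<lambda>C. C \<in> S \<and> degree C = n" M0 "\<lambda>C. degree (lead_coeff C)"] M0
    by (auto simp: n_def)
  note n_min = n_min[folded n_def]
  have primitive: "\<not> [:\<pi>:] dvd M" if "prime_elem \<pi>" for \<pi>
  proof
    assume "[:\<pi>:] dvd M"
    then obtain M' where M': "M = smult \<pi> M'"
      by (auto elim: dvdE)
    have "\<pi> \<noteq> 0" "\<not> \<pi> dvd 1"
      using that by (auto simp: prime_elem_def)
    then have "M' \<in> S" "degree M' = n" "lead_coeff M' \<noteq> 0" "degree \<pi> > 0"
      using M by (auto simp: M' S_def is_unit_iff_degree fps_of_poly_eq_iff[where q = 0, simplified])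
    then show False
      using M_min[of M'] \<open>\<pi> \<noteq> 0\<close> by (simp add: M' degree_mult_eq)
  qed
  \<comment> \<open>Pseudo-division stays inside \<open>k[t][y]\<close>. The remainder annihilates
    \<open>f\<close> and has smaller degree than \<open>M\<close>, so it is zero.\<close>
  obtain Q R where QR: "pseudo_divmod A M = (Q, R)"
    by fastforce
  define c where "c = coeff M (degree M) ^ (Suc (degree A) - degree M)"
  have "M \<noteq> 0"
    using M by (simp add: S_def)
  from pseudo_divmod[OF this QR]
  have div: "smult c A = M * Q + R" and R: "R = 0 \<or> degree R < degree M"
    by (auto simp: c_def)
  have "eval_series R f = 0"
    using arg_cong[OF div, of "\<lambda>C. eval_series C f"] A M by (simp add: S_def)
  then have "R = 0"
    using R M n_min[of R] by (cases "R = 0") (auto simp: S_def)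
  then have "M dvd A"
    using gauss_divides[of M c A Q] primitive div \<open>M \<noteq> 0\<close> by (simp add: c_def mult.commute)
  then obtain Q' where "A = Q' * M"
    by (metis dvdE mult.commute)
  then have "degree (coeff M i) \<le> h" for i
    using A h degree_coeff_factor_le by blast
  moreover have "degree M \<le> d"
    using n_min[of B] B M by (simp add: S_def)
  ultimately show ?thesis
    using that M n_min by (auto simp: S_def)
qed

section \<open>Frobenius on power series, residue classes of exponents, and separability\<close>

lemma sum_by_residues:
  fixes F :: "nat \<Rightarrow> 'a::comm_monoid_add"
  shows "(\<Sum>a<n * p. F a) = (\<Sum>r<p. \<Sum>b<n. F (b * p + r))"
proof -
  have "(\<Sum>a<n * p. F a) = (\<Sum>b<n. \<Sum>r<p. F (b * p + r))"
    unfolding sum.nat_group[symmetric] sum.atLeastLessThan_shift_0[of F "_ * p"]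
    by (simp add: lessThan_atLeast0 add.commute)
  then show ?thesis
    by (subst sum.swap)
qed

text \<open>Additivity of Frobenius for finite sums suffices: \<open>g\<close> is split into its
  terms up to exponent \<open>n\<close> and a tail whose \<open>p\<close>-th power starts only at
  exponent \<open>Suc n * p > n\<close>.\<close>

lemma fps_nth_power_char:
  fixes g :: "'a::comm_ring_1 fps"
  assumes "prime p" and "p = CHAR('a)"
  shows "fps_nth (g ^ p) n = (if p dvd n then fps_nth g (n div p) ^ p else 0)"
proof -
  define s where "s = (\<Sum>i\<le>n. fps_const (fps_nth g i) * fps_X ^ i)"
  have "fps_cutoff (Suc n) g = s"
    by (rule fps_ext) (auto simp: s_def fps_sum_nth if_distrib[of "\<lambda>x. _ * x"] cong: if_cong)
  then have "g = fps_shift (Suc n) g * fps_X ^ Suc n + s"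
    using fps_shift_cutoff[of "Suc n" g] by simp
  then have "g ^ p = (fps_shift (Suc n) g * fps_X ^ Suc n) ^ p + s ^ p"
    using freshmans_dream[of p "fps_shift (Suc n) g * fps_X ^ Suc n" s] assms by simp
  also have "(fps_shift (Suc n) g * fps_X ^ Suc n) ^ p = fps_shift (Suc n) g ^ p * fps_X ^ (Suc n * p)"
    by (simp only: power_mult_distrib power_mult)
  also have "s ^ p = (\<Sum>i\<le>n. fps_const (fps_nth g i ^ p) * fps_X ^ (i * p))"
    using assms unfolding s_def
    by (subst freshmans_dream_sum) (simp_all add: power_mult_distrib power_mult fps_const_power)
  finally have "fps_nth (g ^ p) n =
      fps_nth (fps_shift (Suc n) g ^ p * fps_X ^ (Suc n * p)) n +
      (\<Sum>i\<le>n. fps_nth (fps_const (fps_nth g i ^ p) * fps_X ^ (i * p)) n)"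
    by (simp only: fps_add_nth fps_sum_nth)
  also have "fps_nth (fps_shift (Suc n) g ^ p * fps_X ^ (Suc n * p)) n = 0"
  proof -
    have "n < Suc n * p"
      using prime_gt_0_nat[OF assms(1)] by (cases p) auto
    then show ?thesis
      by (simp only: fps_X_power_mult_right_nth if_True)
  qed
  also have "(\<Sum>i\<le>n. fps_nth (fps_const (fps_nth g i ^ p) * fps_X ^ (i * p)) n) =
      (\<Sum>i\<le>n. if p dvd n \<and> i = n div p then fps_nth g i ^ p else 0)"
    using prime_gt_0_nat[OF assms(1)] by (intro sum.cong) auto
  also have "\<dots> = (if p dvd n then fps_nth g (n div p) ^ p else 0)"
    by (cases "p dvd n") simp_all
  finally show ?thesis
    by simp
qed

lemma fps_nth_X_power_mult_power_char:
  fixes g :: "'a::comm_ring_1 fps"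
  assumes p: "prime p" "p = CHAR('a)" and "r < p"
  shows "fps_nth (fps_X ^ r * g ^ p) n = (if n mod p = r then fps_nth g (n div p) ^ p else 0)"
proof (cases "n < r")
  case True
  then show ?thesis
    using assms(3) by (simp add: fps_X_power_mult_nth)
next
  case False
  then have "p dvd n - r \<longleftrightarrow> n mod p = r"
    using assms(3) by (metis mod_eq_dvd_iff_nat mod_less not_less)
  moreover have "(n - r) div p = n div p" if "n mod p = r"
    using assms(3) minus_mod_eq_div_mult[of n p] that by simp
  ultimately show ?thesis
    using False by (simp add: fps_X_power_mult_nth fps_nth_power_char[OF p])
qed

lemma fps_nth_X_power_mult_power_char':
  fixes g :: "'a::comm_ring_1 fps"
  assumes p: "prime p" "p = CHAR('a)" and "r < p" and "s < p"
  shows "fps_nth (fps_X ^ (b * p + s) * g ^ p) (n * p + r) =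
    (if r = s then fps_nth (fps_X ^ b * g) n ^ p else 0)"
proof -
  have "fps_X ^ (b * p + s) * g ^ p = fps_X ^ s * (fps_X ^ b * g) ^ p"
    by (simp add: power_add power_mult power_mult_distrib mult_ac)
  then show ?thesis
    using assms(3,4) by (simp only: fps_nth_X_power_mult_power_char[OF p \<open>s < p\<close>]) simp
qed

lemma fps_of_poly_altdef:
  assumes "degree q < n"
  shows "fps_of_poly q = (\<Sum>a<n. fps_const (coeff q a) * fps_X ^ a)"
  using assms
  by (intro fps_ext)
    (auto simp: fps_sum_nth if_distrib[of "\<lambda>x. _ * x"] coeff_eq_0 cong: if_cong)

text \<open>
  If \<open>M\<close> were a polynomial in \<open>y ^ p\<close>, comparing coefficients in one residue class mod \<open>p\<close> would give
  a relation over \<open>k\<close> between the \<open>p\<close>-th powers of coefficients of \<open>t ^ b * f ^ i\<close>, which descends to an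
  annihilator of smaller degree. This also covers imperfect \<open>k\<close>.
\<close>

lemma minimal_annihilator_separable:
  fixes f :: "'k::field fps"
  assumes p: "prime p" "p = CHAR('k)"
    and M: "M \<noteq> 0" "eval_series M f = 0"
    and minimal: "\<And>C. C \<noteq> 0 \<Longrightarrow> eval_series C f = 0 \<Longrightarrow> degree M \<le> degree C"
  shows "eval_series (pderiv M) f \<noteq> 0"
proof
  assume deriv0: "eval_series (pderiv M) f = 0"
  have "p > 1"
    using p(1) by (rule prime_gt_1_nat)
  have deg: "degree M > 0"
  proof (rule ccontr)
    assume "\<not> ?thesis"
    then obtain a where "M = [:a:]"
      by (metis degree_0_id neq0_conv)
    then show False
      using M fps_of_poly_eq_iff[of a 0] by simp
  qed
  \<comment> \<open>The derivative would be an annihilator of smaller degree, so it is zero and only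
    exponents of \<open>y\<close> divisible by \<open>p\<close> occur in \<open>M\<close>.\<close>
  have "degree (pderiv M) \<le> degree M - 1"
    by (rule degree_le) (auto simp: coeff_pderiv coeff_eq_0)
  then have "pderiv M = 0"
    using minimal[OF _ deriv0] deg by fastforce
  have coeff0: "coeff M i = 0" if "\<not> p dvd i" for i
  proof (cases i)
    case (Suc n)
    have "of_nat (Suc n) * coeff M (Suc n) = 0"
      using \<open>pderiv M = 0\<close> coeff_pderiv[of M n] by simp
    moreover have "(of_nat (Suc n) :: 'k poly) \<noteq> 0"
      using that p Suc by (simp add: of_nat_eq_0_iff_char_dvd del: of_nat_Suc)
    ultimately show ?thesis
      using Suc by simp
  qed (use that in simp)
  define D T where "D = degree M div p" and "T = t_degree M"
  have pD: "degree M = D * p"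
    using coeff0[of "degree M"] M(1) by (cases "p dvd degree M") (simp_all add: D_def)
  have "D < degree M"
    using deg \<open>p > 1\<close> by (simp add: D_def)
  have "eval_series M f = (\<Sum>i<Suc D * p. fps_of_poly (coeff M i) * f ^ i)"
    unfolding eval_series_altdef using \<open>p > 1\<close>
    by (intro sum.mono_neutral_left) (auto simp: pD coeff_eq_0)
  also have "\<dots> = (\<Sum>s<p. \<Sum>i<Suc D. fps_of_poly (coeff M (i * p + s)) * f ^ (i * p + s))"
    by (rule sum_by_residues)
  also have "\<dots> = (\<Sum>s\<in>{0}. \<Sum>i<Suc D. fps_of_poly (coeff M (i * p + s)) * f ^ (i * p + s))"
    using \<open>p > 1\<close> by (intro sum.mono_neutral_right ballI sum.neutral)
      (auto simp: coeff0 dvd_add_right_iff dest: nat_dvd_not_less)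
  finally have eval_M: "(\<Sum>i<Suc D. fps_of_poly (coeff M (i * p)) * (f ^ i) ^ p) = 0"
    using M(2) by (simp add: power_mult)
  \<comment> \<open>A nonzero coefficient of the leading coefficient selects a residue class
    \<open>r\<close> of exponents of \<open>t\<close> on which the relation stays
    nontrivial.\<close>
  obtain a0 where a0: "coeff (coeff M (D * p)) a0 \<noteq> 0"
    using M(1) pD by (metis leading_coeff_0_iff)
  define r where "r = a0 mod p"
  have "r < p"
    using \<open>p > 1\<close> by (simp add: r_def)
  define J where "J = {..<Suc D} \<times> {..<Suc T}"
  define c where "c j = coeff (coeff M (fst j * p)) (snd j * p + r)" for j
  define u where "u j n = fps_nth (fps_X ^ snd j * f ^ fst j) n" for j n
  have "(\<Sum>j\<in>J. c j * u j n ^ p) = 0" for n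
  proof -
    have "fps_nth (fps_of_poly (coeff M (i * p)) * (f ^ i) ^ p) (n * p + r) =
        (\<Sum>b<Suc T. c (i, b) * u (i, b) n ^ p)" for i
    proof -
      let ?q = "coeff M (i * p)"
      have "T \<le> T * p"
        using \<open>p > 1\<close> by simp
      moreover have "degree ?q \<le> T"
        by (simp add: T_def degree_coeff_le_t_degree)
      ultimately have "degree ?q < Suc T * p"
        unfolding mult_Suc using \<open>p > 1\<close> by linarith
      then have "fps_of_poly ?q * (f ^ i) ^ p =
          (\<Sum>s<p. \<Sum>b<Suc T. fps_const (coeff ?q (b * p + s)) * (fps_X ^ (b * p + s) * (f ^ i) ^ p))"
        by (simp only: fps_of_poly_altdef sum_by_residues sum_distrib_right mult.assoc)
      then have "fps_nth (fps_of_poly ?q * (f ^ i) ^ p) (n * p + r) =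
          (\<Sum>s<p. \<Sum>b<Suc T. coeff ?q (b * p + s) *
            fps_nth (fps_X ^ (b * p + s) * (f ^ i) ^ p) (n * p + r))"
        by (simp only: fps_sum_nth fps_mult_left_const_nth)
      also have "\<dots> = (\<Sum>s<p. \<Sum>b<Suc T.
          if s = r then coeff ?q (b * p + s) * fps_nth (fps_X ^ b * f ^ i) n ^ p else 0)"
        using \<open>r < p\<close> by (intro sum.cong refl) (simp add: fps_nth_X_power_mult_power_char'[OF p])
      also have "\<dots> = (\<Sum>s<p. if s = r then
          \<Sum>b<Suc T. coeff ?q (b * p + s) * fps_nth (fps_X ^ b * f ^ i) n ^ p else 0)"
        by (intro sum.cong refl) simp
      also have "\<dots> = (\<Sum>b<Suc T. c (i, b) * u (i, b) n ^ p)"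
        using \<open>r < p\<close> by (simp add: c_def u_def)
      finally show ?thesis .
    qed
    then have "(\<Sum>i<Suc D. \<Sum>b<Suc T. c (i, b) * u (i, b) n ^ p) =
        fps_nth (\<Sum>i<Suc D. fps_of_poly (coeff M (i * p)) * (f ^ i) ^ p) (n * p + r)"
      by (simp only: fps_sum_nth)
    then show ?thesis
      unfolding eval_M J_def
      by (simp add: sum.cartesian_product case_prod_beta del: sum.lessThan_Suc)
  qed
  moreover have "(D, a0 div p) \<in> J"
  proof -
    have "a0 \<le> T"
      using le_degree[OF a0] degree_coeff_le_t_degree[of M "D * p"] by (simp add: T_def)
    then have "a0 div p \<le> T"
      using div_le_dividend[of a0 p] by (rule order.trans[rotated])
    then show ?thesis
      by (simp add: J_def)
  qed
  moreover have "c (D, a0 div p) \<noteq> 0"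
    using a0 by (simp add: c_def r_def)
  moreover have "finite J"
    by (simp add: J_def)
  ultimately obtain d where d: "\<exists>j\<in>J. d j \<noteq> 0" "\<And>n. (\<Sum>j\<in>J. d j * u j n) = 0"
    using linear_dependence_descends[of "\<lambda>x. x ^ p" J "(D, a0 div p)" c u] \<open>p > 1\<close>
    by (auto simp: frobenius_diff[OF p] power_mult_distrib)
  \<comment> \<open>The descended relation is reassembled into an annihilator of
    \<open>y\<close>-degree at most \<open>D\<close>, which is \<open>degree M\<close> divided by
    \<open>p\<close>.\<close>
  define C where
    "C = (\<Sum>i<Suc D. Polynomial.monom (\<Sum>b<Suc T. Polynomial.monom (d (i, b)) b) i)"
  have "coeff (coeff C i) b = d (i, b)" if "(i, b) \<in> J" for i b
    using that by (simp add: C_def J_def coeff_sum if_distrib[of "\<lambda>q. coeff q b"]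
        cong: if_cong del: sum.lessThan_Suc)
  then have "C \<noteq> 0"
    using d(1) by force
  moreover have "eval_series C f = 0"
  proof (rule fps_ext)
    fix n
    have "eval_series C f = (\<Sum>j\<in>J. fps_const (d j) * (fps_X ^ snd j * f ^ fst j))"
      by (simp add: C_def J_def eval_series_sum eval_series_monom fps_of_poly_sum fps_of_poly_monom
          sum_distrib_right mult.assoc sum.cartesian_product case_prod_beta del: sum.lessThan_Suc)
    then show "fps_nth (eval_series C f) n = fps_nth 0 n"
      using d(2)[of n] by (simp add: fps_sum_nth u_def)
  qed
  moreover have "degree C \<le> D"
    unfolding C_def by (intro degree_sum_le) (auto intro: order.trans[OF degree_monom_le])
  ultimately show False
    using minimal[of C] \<open>D < degree M\<close> by simp
qed

subsection \<open>Frobenius systems\<close>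

lemma pcompose_power: "pcompose (q ^ n) r = pcompose q r ^ n"
  for q r :: "'a::comm_semiring_1 poly"
  by (induction n) (simp_all add: pcompose_1 pcompose_mult)

text \<open>
  Extracting \<open>z ^ (p - 1)\<close> from \<open>(x + z) ^ n\<close> plays the role of the Cartier operator in the
  variable \<open>y\<close>: up to Frobenius, only the exponents \<open>n \<equiv> p - 1 (mod p)\<close> survive.
\<close>

lemma coeff_linear_power_char:
  fixes x :: "'a::comm_ring_1"
  assumes p: "prime p" "p = CHAR('a)"
  shows "coeff ([:x, 1:] ^ n) (p - 1) = (if n mod p = p - 1 then (x ^ (n div p)) ^ p else 0)"
proof -
  have "p > 0"
    using p(1) by (rule prime_gt_0_nat)
  define m s where "m = n div p" and "s = n mod p"
  have n: "n = p * m + s" and "s < p"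
    using \<open>p > 0\<close> by (simp_all add: m_def s_def)
  \<comment> \<open>Multiples of \<open>z\<close> contribute nothing to the coefficient at
    \<open>p - 1\<close>, so the power only has to be known modulo \<open>z\<close>.\<close>
  define z :: "'a poly" where "z = Polynomial.monom 1 p"
  have "[:x, 1:] = [:x:] + Polynomial.monom 1 1"
    by (simp add: monom_Suc monom_0)
  then have "[:x, 1:] ^ p = [:x:] ^ p + Polynomial.monom 1 1 ^ p"
    using freshmans_dream[of p "[:x:]" "Polynomial.monom 1 1"] p by simp
  then have "[:x, 1:] ^ p = [:x ^ p:] + z"
    by (simp add: z_def monom_power poly_const_pow)
  moreover have "\<exists>B. ([:x ^ p:] + z) ^ m = [:(x ^ p) ^ m:] + z * B" for m
  proof (induction m)
    case 0
    show ?case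
      by (rule exI[of _ 0]) simp
  next
    case (Suc m)
    then obtain B where B: "([:x ^ p:] + z) ^ m = [:(x ^ p) ^ m:] + z * B"
      by blast
    have "([:x ^ p:] + z) ^ Suc m =
        [:(x ^ p) ^ Suc m:] + z * ([:x ^ p:] * B + [:(x ^ p) ^ m:] + z * B)"
      unfolding power_Suc B by (simp add: algebra_simps smult_add_right)
    then show ?case
      by blast
  qed
  ultimately obtain B where "([:x, 1:] ^ p) ^ m = [:(x ^ p) ^ m:] + z * B"
    by metis
  then have "[:x, 1:] ^ n = smult ((x ^ p) ^ m) ([:x, 1:] ^ s) + z * (B * [:x, 1:] ^ s)"
    by (simp add: n power_add power_mult distrib_right mult.assoc)
  then have "coeff ([:x, 1:] ^ n) (p - 1) = (x ^ p) ^ m * coeff ([:x, 1:] ^ s) (p - 1)"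
    using \<open>p > 0\<close> by (simp add: z_def coeff_monom_mult)
  also have "coeff ([:x, 1:] ^ s) (p - 1) = (if s = p - 1 then 1 else 0)"
    using \<open>s < p\<close> by (auto simp: coeff_linear_power coeff_eq_0 degree_linear_power)
  finally show ?thesis
    by (simp add: m_def s_def mult.commute flip: power_mult)
qed

lemma coeff_pcompose_linear_char:
  fixes q :: "'a::comm_ring_1 poly"
  assumes p: "prime p" "p = CHAR('a)" and "degree q < n * p"
  shows "coeff (pcompose q [:x, 1:]) (p - 1) =
    (\<Sum>m<n. coeff q (m * p + (p - 1)) * (x ^ m) ^ p)"
proof -
  have "p > 0"
    using p(1) by (rule prime_gt_0_nat)
  have "pcompose q [:x, 1:] = (\<Sum>i\<le>degree q. smult (coeff q i) ([:x, 1:] ^ i))"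
    by (simp add: pcompose_altdef poly_altdef coeff_map_poly degree_map_poly)
  then have "coeff (pcompose q [:x, 1:]) (p - 1) =
      (\<Sum>i\<le>degree q. coeff q i * coeff ([:x, 1:] ^ i) (p - 1))"
    by (simp add: coeff_sum)
  also have "\<dots> = (\<Sum>i<n * p. coeff q i * coeff ([:x, 1:] ^ i) (p - 1))"
    using assms(3) by (intro sum.mono_neutral_left) (auto simp: coeff_eq_0)
  also have "\<dots> = (\<Sum>s<p. \<Sum>m<n. coeff q (m * p + s) * coeff ([:x, 1:] ^ (m * p + s)) (p - 1))"
    by (rule sum_by_residues)
  also have "\<dots> = (\<Sum>s\<in>{p - 1}. \<Sum>m<n. coeff q (m * p + s) * coeff ([:x, 1:] ^ (m * p + s)) (p - 1))"
    using \<open>p > 0\<close> by (intro sum.mono_neutral_right ballI sum.neutral)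
      (auto simp: coeff_linear_power_char[OF p, unfolded One_nat_def])
  finally have "coeff (pcompose q [:x, 1:]) (p - 1) =
      (\<Sum>m<n. coeff q (m * p + (p - 1)) * coeff ([:x, 1:] ^ (m * p + (p - 1))) (p - 1))"
    by simp
  moreover have "coeff ([:x, 1:] ^ (m * p + (p - 1))) (p - 1) = (x ^ m) ^ p" for m
  proof -
    have "(m * p + (p - 1)) mod p = p - 1" "(m * p + (p - 1)) div p = m"
      using \<open>p > 0\<close> by (simp_all only: mod_mult_self3 div_mult_self3) simp_all
    then show ?thesis
      by (simp only: coeff_linear_power_char[OF p] if_True refl)
  qed
  ultimately show ?thesis
    by simp
qed

lemma map_fps_of_poly_mult:
  "map_poly fps_of_poly (A * B) = map_poly fps_of_poly A * map_poly fps_of_poly B"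
  by (rule poly_eqI) (simp add: coeff_mult coeff_map_poly fps_of_poly_sum fps_of_poly_mult)

lemma map_fps_of_poly_power:
  "map_poly fps_of_poly (A ^ n) = map_poly fps_of_poly A ^ n"
  by (induction n) (simp_all add: map_fps_of_poly_mult)

lemma map_fps_of_poly_pderiv:
  fixes A :: "'a::field poly poly"
  shows "map_poly fps_of_poly (pderiv A) = pderiv (map_poly fps_of_poly A)"
proof (rule poly_eqI)
  fix n
  have "fps_of_poly (of_nat (Suc n)) = (of_nat (Suc n) :: 'a fps)"
    by (simp only: of_nat_poly fps_of_poly_const fps_of_nat)
  then show "coeff (map_poly fps_of_poly (pderiv A)) n = coeff (pderiv (map_poly fps_of_poly A)) n"
    by (simp add: coeff_pderiv coeff_map_poly fps_of_poly_mult del: of_nat_Suc)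
qed

text \<open>Substituting \<open>y = f + z\<close> turns \<open>E\<close> into \<open>z\<close> times
  a factor with constant term \<open>E_y(f)\<close>. Hence \<open>P E^(p-1)\<close> becomes
  \<open>z^(p-1)\<close> times a factor with constant term \<open>P(f) E_y(f)^(p-1)\<close>. The
  right-hand side is the same coefficient of \<open>z^(p-1)\<close>, read off from the expansion in
  powers of \<open>y\<close>.\<close>

lemma residue_identity:
  fixes f :: "'k::field fps"
  assumes p: "prime p" "p = CHAR('k)"
    and E: "eval_series E f = 0" and "degree (P * E ^ (p - 1)) < n * p"
  shows "eval_series P f * eval_series (pderiv E) f ^ (p - 1) =
    (\<Sum>m<n. fps_of_poly (coeff (P * E ^ (p - 1)) (m * p + (p - 1))) * (f ^ m) ^ p)"
proof -
  let ?M = "map_poly fps_of_poly"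
  let ?G = "P * E ^ (p - 1)"
  obtain U where U: "?M E = [:- f, 1:] * U"
    using E by (auto simp: eval_series_def poly_eq_0_iff_dvd elim: dvdE)
  have deriv: "poly U f = eval_series (pderiv E) f"
    unfolding eval_series_def map_fps_of_poly_pderiv U pderiv_mult by (simp add: pderiv_pCons)
  have "pcompose (?M E) [:f, 1:] = [:0, 1:] * pcompose U [:f, 1:]"
    unfolding U pcompose_mult by (simp add: pcompose_pCons)
  then have "pcompose (?M ?G) [:f, 1:] =
      Polynomial.monom 1 (p - 1) * (pcompose (?M P) [:f, 1:] * pcompose U [:f, 1:] ^ (p - 1))"
    by (simp add: map_fps_of_poly_mult map_fps_of_poly_power pcompose_mult pcompose_power
        power_mult_distrib monom_altdef mult_ac del: mult_pCons_left mult_pCons_right)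
  then have "coeff (pcompose (?M ?G) [:f, 1:]) (p - 1) =
      coeff (pcompose (?M P) [:f, 1:] * pcompose U [:f, 1:] ^ (p - 1)) 0"
    by (simp add: coeff_monom_mult)
  also have "\<dots> = eval_series P f * eval_series (pderiv E) f ^ (p - 1)"
    by (simp add: coeff_mult_0 coeff_0_power deriv eval_series_def)
  finally show ?thesis
    using coeff_pcompose_linear_char[of p "?M ?G" n f] p assms(4)
    by (simp add: coeff_map_poly degree_map_poly fps_of_poly_eq_iff[where q = 0, simplified])
qed

text \<open>
  The generators \<open>t ^ a * f ^ b / E_y(f)\<close> used below may have poles at \<open>0\<close>. Discarding the polar part is
  harmless because it is compatible with the shape of the recursion.
\<close>

lemma fls_regpart_X_power_mult_power_char:
  fixes u :: "'k::field fls"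
  assumes p: "prime p" "p = CHAR('k)" and "r < p"
  shows "fls_regpart (fls_X ^ r * u ^ p) = fps_X ^ r * fls_regpart u ^ p"
proof (rule fps_ext)
  fix n
  define N where "N = nat (- fls_subdegree u)"
  define g where "g = fls_regpart (fls_X ^ N * u)"
  have "p > 0"
    using p(1) by (rule prime_gt_0_nat)
  have nth_g: "fps_nth g (N + i) = fls_nth u (int i)" for i
    by (simp add: g_def fls_X_power_times_conv_shift)
  have X_u: "fls_X ^ N * u = fps_to_fls g"
    unfolding g_def by (rule fls_regpart_to_fls_trivial[symmetric])
      (cases "u = 0", auto simp: N_def fls_X_power_times_conv_shift)
  have "fls_X ^ (N * p) * (fls_X ^ r * u ^ p) = fls_X ^ r * (fls_X ^ N * u) ^ p"
    by (simp only: power_mult power_mult_distrib mult_ac)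
  also have "\<dots> = fps_to_fls (fps_X ^ r * g ^ p)"
    unfolding X_u by (simp add: fls_times_fps_to_fls fps_to_fls_power)
  finally have "fls_nth (fls_X ^ (N * p) * (fls_X ^ r * u ^ p)) (int (n + N * p)) =
      fps_nth (fps_X ^ r * g ^ p) (n + N * p)"
    by (simp only: fps_to_fls_nth nat_int of_nat_less_0_iff if_False)
  then have "fls_nth (fls_X ^ r * u ^ p) (int n) = fps_nth (fps_X ^ r * g ^ p) (n + N * p)"
    by (simp add: fls_X_power_times_conv_shift(1)[of "N * p"])
  also have "\<dots> = fps_nth (fps_X ^ r * fls_regpart u ^ p) n"
    using \<open>p > 0\<close> by (simp add: fps_nth_X_power_mult_power_char[OF p \<open>r < p\<close>] nth_g)
  finally show "fps_nth (fls_regpart (fls_X ^ r * u ^ p)) n =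
      fps_nth (fps_X ^ r * fls_regpart u ^ p) n"
    by simp
qed

section \<open>From a separable annihilator to a Frobenius system\<close>

lemma degree_coeff_mult_le:
  fixes A B :: "'a::comm_semiring_0 poly poly"
  assumes "\<And>i. degree (coeff A i) \<le> a" and "\<And>i. degree (coeff B i) \<le> b"
  shows "degree (coeff (A * B) i) \<le> a + b"
  unfolding coeff_mult
  by (intro degree_sum_le) (auto intro!: order.trans[OF degree_mult_le] add_mono assms)

lemma degree_coeff_power_le:
  fixes A :: "'a::comm_semiring_1 poly poly"
  assumes "\<And>i. degree (coeff A i) \<le> a"
  shows "degree (coeff (A ^ n) i) \<le> n * a"
proof (induction n arbitrary: i)
  case 0
  show ?case
    by (simp add: coeff_1)
next
  case (Suc n)
  then show ?case
    using degree_coeff_mult_le[OF assms, of "A ^ n" "n * a"] by simp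
qed

text \<open>The coefficients of the \<open>w j ^ p\<close> are polynomials in \<open>t\<close> of
  degree less than \<open>p\<close>. They are kept split into scalars \<open>A r j\<close> and
  powers of \<open>t\<close> because the Lamperti product is bilinear over \<open>k\<close> only, so
  \<open>t^r\<close> has to stay with \<open>w j ^ p\<close>.\<close>

definition frobenius_system :: "nat \<Rightarrow> 'i set \<Rightarrow> ('i \<Rightarrow> 'k::field fps) \<Rightarrow> bool" where
  "frobenius_system p I w \<longleftrightarrow> finite I \<and> (\<forall>i\<in>I. \<exists>A.
     w i = (\<Sum>r<p. \<Sum>j\<in>I. fps_const (A r j) * (fps_X ^ r * w j ^ p)))"

lemma fps_to_fls_sum: "fps_to_fls (sum g A) = (\<Sum>x\<in>A. fps_to_fls (g x))"
  by (induction A rule: infinite_finite_induct) simp_all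

lemma fls_regpart_sum: "fls_regpart (sum g A) = (\<Sum>x\<in>A. fls_regpart (g x))"
  by (induction A rule: infinite_finite_induct) simp_all

lemma fls_regpart_const_mult: "fls_regpart (fls_const c * u) = fps_const c * fls_regpart u"
  for c :: "'a::comm_semiring_1"
  by (rule fps_ext) simp

text \<open>The index set reproduces itself: \<open>P E^(p-1)\<close> has degree at most
  \<open>p d\<close> in \<open>y\<close> and \<open>p h\<close> in \<open>t\<close>, so after
  splitting exponents modulo \<open>p\<close> the quotients are again at most \<open>d\<close> and
  \<open>h\<close>.\<close>

lemma frobenius_system_of_algebraic:
  fixes f :: "'k::field fps"
  assumes p: "prime p" "p = CHAR('k)"
    and E: "eval_series E f = 0" and sep: "eval_series (pderiv E) f \<noteq> 0"
    and deg: "degree E \<le> d" and height: "\<And>i. degree (coeff E i) \<le> h"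
  shows "\<exists>w. frobenius_system p ({..h} \<times> {..d}) w \<and>
    (\<exists>c. f = (\<Sum>i\<in>{..h} \<times> {..d}. fps_const (c i) * w i))"
proof -
  have "p > 0"
    using p(1) by (rule prime_gt_0_nat)
  define e where "e = eval_series (pderiv E) f"
  define V where "V P = fps_to_fls (eval_series P f) / fps_to_fls e" for P
  define v where "v i = fps_to_fls (fps_X ^ fst i * f ^ snd i) / fps_to_fls e" for i :: "nat \<times> nat"
  define w where "w i = fls_regpart (v i)" for i
  define I where "I = {..h} \<times> {..d}"
  have e: "fps_to_fls e \<noteq> 0"
    using sep by (simp add: e_def)
  have expand: "V P = (\<Sum>i\<in>I. fls_const (coeff (coeff P (snd i)) (fst i)) * v i)"
    if "degree P \<le> d" "\<And>i. degree (coeff P i) \<le> h" for P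
  proof -
    have "eval_series P f = (\<Sum>b\<le>d. fps_of_poly (coeff P b) * f ^ b)"
      unfolding eval_series_altdef using that(1)
      by (intro sum.mono_neutral_left) (auto simp: coeff_eq_0)
    also have "\<dots> = (\<Sum>b\<le>d. \<Sum>a\<le>h. fps_const (coeff (coeff P b) a) * (fps_X ^ a * f ^ b))"
      using that(2) by (intro sum.cong refl)
        (simp add: fps_of_poly_altdef[of _ "Suc h"] lessThan_Suc_atMost sum_distrib_right mult.assoc
          less_Suc_eq_le del: sum.lessThan_Suc)
    also have "\<dots> = (\<Sum>i\<in>I. fps_const (coeff (coeff P (snd i)) (fst i)) *
        (fps_X ^ fst i * f ^ snd i))"
      unfolding I_def by (subst sum.swap) (simp add: sum.cartesian_product case_prod_beta)
    finally show ?thesis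
      by (simp add: V_def v_def fps_to_fls_sum sum_divide_distrib fls_times_fps_to_fls[of "fps_const _"]
          fps_const_to_fls)
  qed
  have recursion: "\<exists>A. V P = (\<Sum>r<p. \<Sum>i\<in>I. fls_const (A r i) * (fls_X ^ r * v i ^ p))"
    if P: "degree P \<le> d" "\<And>i. degree (coeff P i) \<le> h" for P
  proof -
    define G where "G = P * E ^ (p - 1)"
    define A where "A r i = coeff (coeff G (snd i * p + (p - 1))) (fst i * p + r)" for r i
    have "degree G \<le> degree P + (p - 1) * degree E"
      unfolding G_def using degree_mult_le[of P "E ^ (p - 1)"] degree_power_le[of E "p - 1"]
      by (simp add: mult.commute)
    also have "\<dots> \<le> d + (p - 1) * d"
      using P(1) deg by (intro add_mono mult_le_mono2)
    also have "\<dots> < Suc d * p"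
      using \<open>p > 0\<close> by (cases p) (auto simp: algebra_simps)
    finally have deg_G: "degree G < Suc d * p" .
    have "degree (coeff G i) < Suc h * p" for i
    proof -
      have "degree (coeff G i) \<le> h + (p - 1) * h"
        unfolding G_def using P(2) degree_coeff_power_le[OF height] by (rule degree_coeff_mult_le)
      also have "\<dots> < Suc h * p"
        using \<open>p > 0\<close> by (cases p) (auto simp: algebra_simps)
      finally show ?thesis .
    qed
    then have coeff_G: "fps_of_poly (coeff G i) =
        (\<Sum>r<p. \<Sum>b<Suc h. fps_const (coeff (coeff G i) (b * p + r)) * fps_X ^ (b * p + r))" for i
      by (simp only: fps_of_poly_altdef[where n = "Suc h * p"] sum_by_residues)
    have "eval_series P f * e ^ (p - 1) =
        (\<Sum>m<Suc d. fps_of_poly (coeff G (m * p + (p - 1))) * (f ^ m) ^ p)"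
      unfolding e_def G_def using deg_G by (intro residue_identity[OF p E]) (simp add: G_def)
    also have "\<dots> = (\<Sum>m<Suc d. \<Sum>r<p. \<Sum>b<Suc h.
        fps_const (coeff (coeff G (m * p + (p - 1))) (b * p + r)) *
          (fps_X ^ r * (fps_X ^ b * f ^ m) ^ p))"
      unfolding coeff_G sum_distrib_right
      by (intro sum.cong refl) (simp add: power_add power_mult power_mult_distrib mult_ac)
    also have "\<dots> = (\<Sum>r<p. \<Sum>m<Suc d. \<Sum>b<Suc h.
        fps_const (coeff (coeff G (m * p + (p - 1))) (b * p + r)) *
          (fps_X ^ r * (fps_X ^ b * f ^ m) ^ p))"
      by (rule sum.swap)
    also have "\<dots> = (\<Sum>r<p. \<Sum>b<Suc h. \<Sum>m<Suc d.
        fps_const (coeff (coeff G (m * p + (p - 1))) (b * p + r)) *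
          (fps_X ^ r * (fps_X ^ b * f ^ m) ^ p))"
      by (rule sum.cong[OF refl], rule sum.swap)
    also have "\<dots> = (\<Sum>r<p. \<Sum>i\<in>I. fps_const (A r i) * (fps_X ^ r * (fps_X ^ fst i * f ^ snd i) ^ p))"
      by (simp add: I_def A_def sum.cartesian_product case_prod_beta lessThan_Suc_atMost
          del: sum.lessThan_Suc)
    finally have "fps_to_fls (eval_series P f) * fps_to_fls e ^ (p - 1) =
        (\<Sum>r<p. \<Sum>i\<in>I. fls_const (A r i) * (fls_X ^ r * fps_to_fls (fps_X ^ fst i * f ^ snd i) ^ p))"
      by (simp only: fls_times_fps_to_fls[symmetric] fps_to_fls_power[symmetric]
          fps_to_fls_sum[symmetric] fps_const_to_fls[symmetric] fps_X_to_fls[symmetric])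
    \<comment> \<open>Expanding the fraction by \<open>e^(p-1)\<close> makes the residue identity
      applicable and turns the denominator into a \<open>p\<close>-th power, which the generators
      \<open>v i ^ p\<close> absorb.\<close>
    moreover have "V P = fps_to_fls (eval_series P f) * fps_to_fls e ^ (p - 1) / fps_to_fls e ^ p"
      using e \<open>p > 0\<close> by (simp add: V_def power_eq_if[of _ p])
    ultimately have "V P = (\<Sum>r<p. \<Sum>i\<in>I.
        fls_const (A r i) * (fls_X ^ r * fps_to_fls (fps_X ^ fst i * f ^ snd i) ^ p)) / fps_to_fls e ^ p"
      by simp
    then show ?thesis
      by (intro exI[of _ A]) (simp add: v_def sum_divide_distrib power_divide)
  qed
  have "frobenius_system p I w"
    unfolding frobenius_system_def
  proof (intro conjI ballI)
    show "finite I"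
      by (simp add: I_def)
    fix i assume "i \<in> I"
    define P where "P = Polynomial.monom (Polynomial.monom (1::'k) (fst i)) (snd i)"
    have "V P = v i"
      by (simp add: V_def v_def P_def eval_series_monom fps_of_poly_monom)
    moreover have "degree P \<le> d" "\<And>j. degree (coeff P j) \<le> h"
      using \<open>i \<in> I\<close> by (auto simp: P_def I_def intro: order.trans[OF degree_monom_le])
    ultimately obtain A where "v i = (\<Sum>r<p. \<Sum>j\<in>I. fls_const (A r j) * (fls_X ^ r * v j ^ p))"
      using recursion[of P] by auto
    then have "w i = fls_regpart (\<Sum>r<p. \<Sum>j\<in>I. fls_const (A r j) * (fls_X ^ r * v j ^ p))"
      by (simp only: w_def)
    then have "w i = (\<Sum>r<p. \<Sum>j\<in>I. fps_const (A r j) * (fps_X ^ r * w j ^ p))"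
      by (simp add: fls_regpart_sum fls_regpart_const_mult fls_regpart_X_power_mult_power_char[OF p] w_def)
    then show "\<exists>A. w i = (\<Sum>r<p. \<Sum>j\<in>I. fps_const (A r j) * (fps_X ^ r * w j ^ p))"
      by blast
  qed
  moreover have "\<exists>c. f = (\<Sum>i\<in>I. fps_const (c i) * w i)"
  proof -
    \<comment> \<open>This is \<open>y E_y\<close>, which respects both degree bounds and satisfies
      \<open>P(f) / E_y(f) = f\<close>; multiplying by \<open>y\<close> compensates the degree lost
      in the derivative.\<close>
    define P where "P = pCons 0 (pderiv E)"
    have coeff_P: "coeff P i = of_nat i * coeff E i" for i
      by (cases i) (simp_all add: P_def coeff_pderiv)
    have "degree P \<le> d"
      using deg by (intro degree_le) (simp add: coeff_P coeff_eq_0)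
    moreover have "degree (coeff P i) \<le> h" for i
      unfolding coeff_P of_nat_poly using height[of i] degree_smult_le[of "of_nat i" "coeff E i"]
      by simp
    ultimately have "V P = (\<Sum>i\<in>I. fls_const (coeff (coeff P (snd i)) (fst i)) * v i)"
      by (rule expand)
    moreover have "V P = fps_to_fls f"
      using e by (simp add: V_def P_def e_def fls_times_fps_to_fls)
    ultimately have "f = fls_regpart (\<Sum>i\<in>I. fls_const (coeff (coeff P (snd i)) (fst i)) * v i)"
      using fls_regpart_fps_trivial[of f] by simp
    then show ?thesis
      by (intro exI) (simp add: fls_regpart_sum fls_regpart_const_mult w_def)
  qed
  ultimately show ?thesis
    unfolding I_def by blast
qed

lemma annihilator_of_polynomial_system:
  fixes W :: "'i \<Rightarrow> 'k::field fps"
  assumes p: "prime p" "p = CHAR('k)" and I: "finite I" "I \<noteq> {}"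
    and system: "\<And>i. i \<in> I \<Longrightarrow> W i = (\<Sum>j\<in>I. fps_of_poly (B i j) * W j ^ p)"
    and L: "L = (\<Sum>i\<in>I. fps_of_poly (b i) * W i)"
  shows "\<exists>A. A \<noteq> 0 \<and> eval_series A L = 0 \<and> degree A \<le> p ^ card I - 1"
proof (cases "L = 0")
  case True
  \<comment> \<open>Division by \<open>L\<close> is used below, so \<open>L = 0\<close> is separate:
    the annihilator \<open>y\<close> has degree 1, within the bound because \<open>I\<close> is
    nonempty.\<close>
  have "p ^ card I > 1"
    using I prime_gt_1_nat[OF p(1)] by (intro one_less_power) (auto simp: card_gt_0_iff)
  then show ?thesis
    using True by (intro exI[of _ "[:0, 1:]"]) auto
next
  case False
  have "p > 1"
    using p(1) by (rule prime_gt_1_nat)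
  define m where "m = card I"
  have frobenius_sum: "(\<Sum>i\<in>S. g i) ^ (p ^ n) = (\<Sum>i\<in>S. g i ^ (p ^ n))"
    for g :: "'i \<Rightarrow> 'k fps" and S n
    using p by (intro freshmans_dream_sum') auto
  have iterate: "\<exists>C. \<forall>i\<in>I. W i = (\<Sum>j\<in>I. fps_of_poly (C i j) * W j ^ (p ^ n))" for n
  proof (induction n)
    case 0
    show ?case
    proof (intro exI ballI)
      fix i assume "i \<in> I"
      then show "W i = (\<Sum>j\<in>I. fps_of_poly (if i = j then 1 else 0) * W j ^ (p ^ 0))"
        using I by (simp add: if_distrib[of fps_of_poly] if_distrib[of "\<lambda>x. x * _"] cong: if_cong)
    qed
  next
    case (Suc n)
    then obtain C where C: "\<And>i. i \<in> I \<Longrightarrow> W i = (\<Sum>j\<in>I. fps_of_poly (C i j) * W j ^ (p ^ n))"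
      by blast
    have "W i = (\<Sum>l\<in>I. fps_of_poly (\<Sum>j\<in>I. C i j * B j l ^ (p ^ n)) * W l ^ (p ^ Suc n))"
      if "i \<in> I" for i
    proof -
      have "W i = (\<Sum>j\<in>I. fps_of_poly (C i j) * (\<Sum>l\<in>I. fps_of_poly (B j l) * W l ^ p) ^ (p ^ n))"
        using C[OF that] system by simp
      also have "\<dots> = (\<Sum>j\<in>I. \<Sum>l\<in>I. fps_of_poly (C i j * B j l ^ (p ^ n)) * W l ^ (p ^ Suc n))"
        unfolding frobenius_sum
        by (simp add: sum_distrib_left fps_of_poly_mult fps_of_poly_power power_mult_distrib power_mult
            mult.assoc)
      also have "\<dots> = (\<Sum>l\<in>I. \<Sum>j\<in>I. fps_of_poly (C i j * B j l ^ (p ^ n)) * W l ^ (p ^ Suc n))"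
        by (rule sum.swap)
      finally show ?thesis
        by (simp add: fps_of_poly_sum sum_distrib_right)
    qed
    then show ?case
      by (intro exI[of _ "\<lambda>i l. \<Sum>j\<in>I. C i j * B j l ^ (p ^ n)"]) blast
  qed
  \<comment> \<open>All these powers are brought to the common family \<open>W l ^ (p ^ m)\<close>:
    the system is iterated \<open>m - j\<close> times and Frobenius supplies the other
    \<open>j\<close> steps. This gives \<open>m + 1\<close> vectors of length
    \<open>m\<close>.\<close>
  have "\<exists>D. L ^ (p ^ j) = (\<Sum>l\<in>I. fps_of_poly (D l) * W l ^ (p ^ m))" if "j \<le> m" for j
  proof -
    obtain C where C: "\<And>i. i \<in> I \<Longrightarrow> W i = (\<Sum>l\<in>I. fps_of_poly (C i l) * W l ^ (p ^ (m - j)))"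
      using iterate by blast
    have exponent: "p ^ (m - j) * p ^ j = p ^ m"
      using that by (simp flip: power_add)
    have "L ^ (p ^ j) = (\<Sum>i\<in>I. (fps_of_poly (b i) *
        (\<Sum>l\<in>I. fps_of_poly (C i l) * W l ^ (p ^ (m - j)))) ^ (p ^ j))"
      unfolding L frobenius_sum using C by simp
    also have "\<dots> = (\<Sum>i\<in>I. \<Sum>l\<in>I. fps_of_poly (b i ^ (p ^ j) * C i l ^ (p ^ j)) * W l ^ (p ^ m))"
      unfolding power_mult_distrib frobenius_sum exponent[symmetric] power_mult
      by (simp add: sum_distrib_left fps_of_poly_mult fps_of_poly_power mult.assoc)
    also have "\<dots> = (\<Sum>l\<in>I. \<Sum>i\<in>I. fps_of_poly (b i ^ (p ^ j) * C i l ^ (p ^ j)) * W l ^ (p ^ m))"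
      by (rule sum.swap)
    finally show ?thesis
      by (intro exI[of _ "\<lambda>l. \<Sum>i\<in>I. b i ^ (p ^ j) * C i l ^ (p ^ j)"])
        (simp add: fps_of_poly_sum sum_distrib_right)
  qed
  then obtain D where
    D: "\<And>j. j \<le> m \<Longrightarrow> L ^ (p ^ j) = (\<Sum>l\<in>I. fps_of_poly (D j l) * W l ^ (p ^ m))"
    by metis
  obtain c j0 where j0: "j0 \<le> m" "c j0 \<noteq> 0"
    and c: "\<And>l. l \<in> I \<Longrightarrow> (\<Sum>j\<le>m. c j * D j l) = 0"
    using linear_relation_exists[of I "{..m}" D] I by (auto simp: m_def)
  have "(\<Sum>j\<le>m. fps_of_poly (c j) * L ^ (p ^ j)) =
      (\<Sum>j\<le>m. \<Sum>l\<in>I. fps_of_poly (c j * D j l) * W l ^ (p ^ m))"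
    using D by (simp add: sum_distrib_left fps_of_poly_mult mult.assoc)
  also have "\<dots> = (\<Sum>l\<in>I. \<Sum>j\<le>m. fps_of_poly (c j * D j l) * W l ^ (p ^ m))"
    by (rule sum.swap)
  also have "\<dots> = 0"
    using c by (simp flip: sum_distrib_right fps_of_poly_sum)
  finally have relation: "(\<Sum>j\<le>m. fps_of_poly (c j) * L ^ (p ^ j)) = 0" .
  \<comment> \<open>Every term of the relation is divisible by \<open>L\<close>; removing one factor
    lowers each exponent by one and accounts for the \<open>- 1\<close> in the bound.\<close>
  define A where "A = (\<Sum>j\<le>m. Polynomial.monom (c j) (p ^ j - 1))"
  have pos: "p ^ j > 0" for j
    using \<open>p > 1\<close> by simp
  have "L * eval_series A L = (\<Sum>j\<le>m. fps_of_poly (c j) * L ^ (p ^ j))"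
    unfolding A_def eval_series_sum eval_series_monom sum_distrib_left
  proof (intro sum.cong refl)
    fix j
    have "L ^ (p ^ j - 1) * L = L ^ (p ^ j)"
      using pos by (rule power_minus_mult)
    from this[symmetric]
    show "L * (fps_of_poly (c j) * L ^ (p ^ j - 1)) = fps_of_poly (c j) * L ^ (p ^ j)"
      by (simp only: mult_ac)
  qed
  then have "eval_series A L = 0"
    using relation False by simp
  moreover have "coeff A (p ^ j0 - 1) = c j0"
  proof -
    \<comment> \<open>Distinct exponents rule out cancellation, so \<open>A\<close> is
      nonzero.\<close>
    have "p ^ j - 1 = p ^ j0 - 1 \<longleftrightarrow> j = j0" for j
    proof
      assume "p ^ j - 1 = p ^ j0 - 1"
      then have "p ^ j = p ^ j0"
        using pos[of j] pos[of j0] by linarith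
      then show "j = j0"
        using \<open>p > 1\<close> power_inject_exp by blast
    qed simp
    then show ?thesis
      using j0(1) by (simp add: A_def coeff_sum)
  qed
  moreover have "degree A \<le> p ^ m - 1"
    unfolding A_def using \<open>p > 1\<close>
    by (intro degree_sum_le)
      (auto intro!: order.trans[OF degree_monom_le] diff_le_mono power_increasing)
  ultimately show ?thesis
    using j0 unfolding m_def by (intro exI[of _ A]) auto
qed

subsection \<open>The Lamperti product\<close>

definition poly_pairing :: "'a::comm_ring_1 fps \<Rightarrow> 'a poly \<Rightarrow> 'a" where
  "poly_pairing u q = (\<Sum>m\<le>degree q. coeff q m * fps_nth u m)"

text \<open>The functional on \<open>k[x][y]\<close> sending \<open>x^m y^n\<close> to
  \<open>u_m v_n\<close>, with the inner variable \<open>x\<close> paired with \<open>u\<close>. It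
  stands for the constant term of \<open>u(1/x) v(1/y) A(x,y)\<close>.\<close>

definition bipoly_pairing :: "'a::comm_ring_1 fps \<Rightarrow> 'a fps \<Rightarrow> 'a poly poly \<Rightarrow> 'a" where
  "bipoly_pairing u v A = poly_pairing v (map_poly (poly_pairing u) A)"

lemma poly_pairing_bound:
  assumes "degree q \<le> N"
  shows "poly_pairing u q = (\<Sum>m\<le>N. coeff q m * fps_nth u m)"
  unfolding poly_pairing_def using assms
  by (intro sum.mono_neutral_left) (auto simp: coeff_eq_0)

lemma poly_pairing_0 [simp]: "poly_pairing u 0 = 0"
  by (simp add: poly_pairing_def)

lemma poly_pairing_add: "poly_pairing u (q + r) = poly_pairing u q + poly_pairing u r"
proof -
  define N where "N = max (degree q) (degree r)"
  have "degree q \<le> N" "degree r \<le> N" "degree (q + r) \<le> N"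
    by (simp_all add: N_def degree_add_le_max)
  then show ?thesis
    by (simp add: poly_pairing_bound distrib_right sum.distrib)
qed

lemma poly_pairing_monom: "poly_pairing u (Polynomial.monom c n) = c * fps_nth u n"
  using poly_pairing_bound[OF degree_monom_le[of c n], of u]
  by (simp add: if_distrib[of "\<lambda>x. x * _"] cong: if_cong)

lemma bipoly_pairing_0 [simp]: "bipoly_pairing u v 0 = 0"
  by (simp add: bipoly_pairing_def)

lemma bipoly_pairing_add:
  "bipoly_pairing u v (A + B) = bipoly_pairing u v A + bipoly_pairing u v B"
proof -
  have "map_poly (poly_pairing u) (A + B) = map_poly (poly_pairing u) A + map_poly (poly_pairing u) B"
    by (rule poly_eqI) (simp add: coeff_map_poly poly_pairing_add)
  then show ?thesis
    by (simp add: bipoly_pairing_def poly_pairing_add)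
qed

lemma bipoly_pairing_sum:
  "bipoly_pairing u v (\<Sum>i\<in>S. A i) = (\<Sum>i\<in>S. bipoly_pairing u v (A i))"
  by (induction S rule: infinite_finite_induct) (simp_all add: bipoly_pairing_add)

lemma bipoly_pairing_of_nat:
  "bipoly_pairing u v (of_nat n * A) = of_nat n * bipoly_pairing u v A"
  by (induction n) (simp_all add: bipoly_pairing_add algebra_simps)

definition bimonom :: "'a::zero \<Rightarrow> nat \<Rightarrow> nat \<Rightarrow> 'a poly poly" where
  "bimonom c m n = Polynomial.monom (Polynomial.monom c m) n"

lemma bimonom_mult:
  "bimonom c m n * bimonom c' m' n' = bimonom (c * c') (m + m') (n + n')"
  by (simp add: bimonom_def mult_monom)

lemma bimonom_power: "bimonom c m n ^ k = bimonom (c ^ k) (m * k) (n * k)"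
  for c :: "'a::comm_ring_1"
  by (simp add: bimonom_def monom_power mult.commute)

lemma bipoly_pairing_bimonom:
  "bipoly_pairing u v (bimonom c m n) = c * fps_nth u m * fps_nth v n"
  by (simp add: bipoly_pairing_def bimonom_def map_poly_monom poly_pairing_monom)

lemma bipoly_as_sum_of_bimonoms:
  fixes A :: "'a::comm_ring_1 poly poly"
  assumes "degree A < N" and "\<And>n. degree (coeff A n) < M"
  shows "A = (\<Sum>t\<in>{..<M} \<times> {..<N}. bimonom (coeff (coeff A (snd t)) (fst t)) (fst t) (snd t))"
proof (intro poly_eqI)
  fix n m
  have "coeff (coeff (\<Sum>t\<in>{..<M} \<times> {..<N}.
      bimonom (coeff (coeff A (snd t)) (fst t)) (fst t) (snd t)) n) m =
      (\<Sum>t\<in>{..<M} \<times> {..<N}. if t = (m, n) then coeff (coeff A n) m else 0)"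
    unfolding coeff_sum by (intro sum.cong) (auto simp: bimonom_def)
  also have "\<dots> = (if m < M \<and> n < N then coeff (coeff A n) m else 0)"
    by simp
  also have "\<dots> = coeff (coeff A n) m"
    using assms(1) assms(2)[of n] by (auto simp: coeff_eq_0)
  finally show "coeff (coeff A n) m = coeff (coeff (\<Sum>t\<in>{..<M} \<times> {..<N}.
      bimonom (coeff (coeff A (snd t)) (fst t)) (fst t) (snd t)) n) m" ..
qed

text \<open>Modulo \<open>p\<close>, the exponents in \<open>A^p B\<close> are those of
  \<open>B\<close>, while \<open>X^a u^p\<close> and \<open>X^b v^p\<close> see only the classes of
  \<open>a\<close> and \<open>b\<close>. As \<open>B\<close> has degree below \<open>p\<close> in
  both variables, exactly its coefficient at \<open>x^a y^b\<close> survives; the rest is a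
  \<open>p\<close>-th power by additivity of Frobenius.\<close>

lemma bipoly_pairing_frobenius:
  fixes u v :: "'k::field fps"
  assumes p: "prime p" "p = CHAR('k)" and "a < p" and "b < p"
    and B: "degree B < p" "\<And>n. degree (coeff B n) < p"
  shows "bipoly_pairing (fps_X ^ a * u ^ p) (fps_X ^ b * v ^ p) (A ^ p * B) =
    coeff (coeff B b) a * bipoly_pairing u v A ^ p"
proof -
  define S where "S = {..<Suc (t_degree A)} \<times> {..<Suc (degree A)}"
  define T where "T = {..<p} \<times> {..<p}"
  define \<alpha> where "\<alpha> t = coeff (coeff A (snd t)) (fst t)" for t
  define \<beta> where "\<beta> t = coeff (coeff B (snd t)) (fst t)" for t
  have A: "A = (\<Sum>t\<in>S. bimonom (\<alpha> t) (fst t) (snd t))"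
    unfolding S_def \<alpha>_def
    by (rule bipoly_as_sum_of_bimonoms) (auto simp: le_imp_less_Suc degree_coeff_le_t_degree)
  have B: "B = (\<Sum>t\<in>T. bimonom (\<beta> t) (fst t) (snd t))"
    unfolding T_def \<beta>_def using B by (rule bipoly_as_sum_of_bimonoms)
  have "A ^ p = (\<Sum>t\<in>S. bimonom (\<alpha> t) (fst t) (snd t) ^ p)"
    using p by (subst A, subst freshmans_dream_sum) auto
  then have "A ^ p * B = (\<Sum>t\<in>S. \<Sum>s\<in>T.
      bimonom (\<alpha> t ^ p * \<beta> s) (fst t * p + fst s) (snd t * p + snd s))"
    by (subst B) (simp add: sum_product bimonom_power bimonom_mult)
  then have "bipoly_pairing (fps_X ^ a * u ^ p) (fps_X ^ b * v ^ p) (A ^ p * B) =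
      (\<Sum>t\<in>S. \<Sum>s\<in>T. \<alpha> t ^ p * \<beta> s * fps_nth (fps_X ^ a * u ^ p) (fst t * p + fst s) *
        fps_nth (fps_X ^ b * v ^ p) (snd t * p + snd s))"
    by (simp add: bipoly_pairing_sum bipoly_pairing_bimonom)
  also have "\<dots> = (\<Sum>t\<in>S. \<Sum>s\<in>T. if s = (a, b) then
      (\<alpha> t * fps_nth u (fst t) * fps_nth v (snd t)) ^ p * \<beta> s else 0)"
    using assms(3,4)
    by (intro sum.cong refl)
      (auto simp: T_def fps_nth_X_power_mult_power_char[OF p] power_mult_distrib)
  also have "\<dots> = (\<Sum>t\<in>S. (\<alpha> t * fps_nth u (fst t) * fps_nth v (snd t)) ^ p) * \<beta> (a, b)"
    using assms(3,4) by (simp add: T_def sum_distrib_right)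
  also have "(\<Sum>t\<in>S. (\<alpha> t * fps_nth u (fst t) * fps_nth v (snd t)) ^ p) =
      (\<Sum>t\<in>S. \<alpha> t * fps_nth u (fst t) * fps_nth v (snd t)) ^ p"
    using p by (simp add: freshmans_dream_sum)
  also have "(\<Sum>t\<in>S. \<alpha> t * fps_nth u (fst t) * fps_nth v (snd t)) = bipoly_pairing u v A"
    by (subst A) (simp add: bipoly_pairing_sum bipoly_pairing_bimonom)
  finally show ?thesis
    by (simp add: \<beta>_def mult.commute)
qed

text \<open>
  The coefficient of \<open>t ^ i\<close> in the Lamperti product pairs \<open>f(x) g(y)\<close> with the \<open>i\<close>-th power of
  \<open>\<alpha> x + \<gamma> y + \<beta> x y\<close>.
\<close>

definition lamperti_kernel :: "'k::field \<Rightarrow> 'k \<Rightarrow> 'k \<Rightarrow> 'k poly poly" where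
  "lamperti_kernel \<alpha> \<beta> \<gamma> = bimonom \<alpha> 1 0 + (bimonom \<beta> 1 1 + bimonom \<gamma> 0 1)"

lemma multinomial_eq_binomials:
  fixes i j m :: nat
  assumes "j + m \<le> i"
  shows "fact i div (fact j * fact m * fact (i - j - m)) = (i choose j) * ((i - j) choose m)"
proof -
  have "fact i = (fact j * fact (i - j) * (i choose j) :: nat)"
    using binomial_fact_lemma[of j i] assms by simp
  also have "fact (i - j) = (fact m * fact (i - j - m) * ((i - j) choose m) :: nat)"
    using binomial_fact_lemma[of m "i - j"] assms by simp
  finally have "fact i = (fact j * fact m * fact (i - j - m)) * ((i choose j) * ((i - j) choose m))"
    by (simp only: mult_ac)
  then show ?thesis
    by simp
qed

text \<open>Two applications of the binomial theorem expand the kernel: \<open>j\<close> factors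
  \<alpha> x, \<open>m\<close> factors \<beta> x y and \<open>l = i - j - m\<close> factors \<gamma>
  y give the monomial \<open>x^(j+m) y^(l+m)\<close>, whose second exponent is
  \<open>i - j\<close>.\<close>

lemma fps_nth_lamperti_product:
  "fps_nth (lamperti_product \<alpha> \<beta> \<gamma> f g) i = bipoly_pairing f g (lamperti_kernel \<alpha> \<beta> \<gamma> ^ i)"
proof -
  have "lamperti_kernel \<alpha> \<beta> \<gamma> ^ i = (\<Sum>j\<le>i. \<Sum>m\<le>i - j. of_nat ((i choose j) * ((i - j) choose m)) *
      bimonom (\<alpha> ^ j * \<beta> ^ m * \<gamma> ^ (i - j - m)) (j + m) (i - j))"
    unfolding lamperti_kernel_def binomial_ring sum_distrib_left
  proof (intro sum.cong refl)
    fix j m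
    have "of_nat (i choose j) * bimonom \<alpha> 1 0 ^ j * (of_nat ((i - j) choose m) *
        bimonom \<beta> 1 1 ^ m * bimonom \<gamma> 0 1 ^ (i - j - m)) =
        of_nat ((i choose j) * ((i - j) choose m)) *
        (bimonom \<alpha> 1 0 ^ j * bimonom \<beta> 1 1 ^ m * bimonom \<gamma> 0 1 ^ (i - j - m))"
      by (simp only: of_nat_mult mult_ac)
    moreover assume "m \<in> {..i - j}"
    then have "m + (i - (j + m)) = i - j"
      by auto
    ultimately show "of_nat (i choose j) * bimonom \<alpha> 1 0 ^ j * (of_nat ((i - j) choose m) *
        bimonom \<beta> 1 1 ^ m * bimonom \<gamma> 0 1 ^ (i - j - m)) =
        of_nat ((i choose j) * ((i - j) choose m)) *
        bimonom (\<alpha> ^ j * \<beta> ^ m * \<gamma> ^ (i - j - m)) (j + m) (i - j)"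
      by (simp add: bimonom_power bimonom_mult mult.assoc)
  qed
  then have "bipoly_pairing f g (lamperti_kernel \<alpha> \<beta> \<gamma> ^ i) =
      (\<Sum>j\<le>i. \<Sum>m\<le>i - j. of_nat ((i choose j) * ((i - j) choose m)) *
        (\<alpha> ^ j * \<beta> ^ m * \<gamma> ^ (i - j - m) * fps_nth f (j + m) * fps_nth g (i - j)))"
    by (simp only: bipoly_pairing_sum bipoly_pairing_of_nat bipoly_pairing_bimonom)
  also have "\<dots> = (\<Sum>j\<le>i. \<Sum>m\<le>i - j. of_nat (fact i div (fact j * fact m * fact (i - j - m))) *
        \<alpha> ^ j * \<beta> ^ m * \<gamma> ^ (i - j - m) * fps_nth f (j + m) * fps_nth g (i - j - m + m))"
  proof (intro sum.cong refl)
    fix j m assume "j \<in> {..i}" "m \<in> {..i - j}"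
    then have "j + m \<le> i" and "i - j - m + m = i - j"
      by auto
    then show "of_nat ((i choose j) * ((i - j) choose m)) *
        (\<alpha> ^ j * \<beta> ^ m * \<gamma> ^ (i - j - m) * fps_nth f (j + m) * fps_nth g (i - j)) =
        of_nat (fact i div (fact j * fact m * fact (i - j - m))) *
        \<alpha> ^ j * \<beta> ^ m * \<gamma> ^ (i - j - m) * fps_nth f (j + m) * fps_nth g (i - j - m + m)"
      by (simp only: multinomial_eq_binomials) (simp only: mult.assoc)
  qed
  also have "\<dots> = (\<Sum>(j, m)\<in>Sigma {..i} (\<lambda>j. {..i - j}).
      of_nat (fact i div (fact j * fact m * fact (i - j - m))) *
        \<alpha> ^ j * \<beta> ^ m * \<gamma> ^ (i - j - m) * fps_nth f (j + m) * fps_nth g (i - j - m + m))"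
    by (rule sum.Sigma) auto
  also have "\<dots> = (\<Sum>(j, m, l) \<in> {(j, m, l). j + m + l = i}.
       of_nat (fact i div (fact j * fact m * fact l)) * \<alpha> ^ j * \<beta> ^ m * \<gamma> ^ l
         * fps_nth f (j + m) * fps_nth g (l + m))"
    by (rule sum.reindex_bij_witness[where i = "\<lambda>(j, m, l). (j, m)" and j = "\<lambda>(j, m). (j, m, i - j - m)"])
      auto
  finally show ?thesis
    by (simp add: lamperti_product_def)
qed

lemma lamperti_product_sum_left:
  "lamperti_product \<alpha> \<beta> \<gamma> (\<Sum>t\<in>T. fps_const (c t) * F t) g =
    (\<Sum>t\<in>T. fps_const (c t) * lamperti_product \<alpha> \<beta> \<gamma> (F t) g)"
  by (rule fps_ext)
    (simp add: lamperti_product_def fps_sum_nth case_prod_beta sum_distrib_left sum_distrib_right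
      sum.swap[of _ T] mult_ac)

lemma lamperti_product_sum_right:
  "lamperti_product \<alpha> \<beta> \<gamma> f (\<Sum>t\<in>T. fps_const (c t) * G t) =
    (\<Sum>t\<in>T. fps_const (c t) * lamperti_product \<alpha> \<beta> \<gamma> f (G t))"
  by (rule fps_ext)
    (simp add: lamperti_product_def fps_sum_nth case_prod_beta sum_distrib_left sum_distrib_right
      sum.swap[of _ T] mult_ac)

text \<open>For \<open>i = i' p + e\<close> with \<open>e < p\<close>, the kernel power splits as
  \<open>(Q^i')^p Q^e\<close>. The kernel has degree at most 1 in each variable, so
  \<open>Q^e\<close> has degree below \<open>p\<close> and the pairing factors.\<close>

lemma lamperti_product_frobenius:
  fixes \<alpha> \<beta> \<gamma> :: "'k::field"
  assumes p: "prime p" "p = CHAR('k)"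
  shows "\<exists>R. \<forall>a<p. \<forall>b<p. \<forall>u v. lamperti_product \<alpha> \<beta> \<gamma> (fps_X ^ a * u ^ p) (fps_X ^ b * v ^ p) =
    fps_of_poly (R a b) * lamperti_product \<alpha> \<beta> \<gamma> u v ^ p"
proof -
  let ?L = "lamperti_product \<alpha> \<beta> \<gamma>"
  define Q where "Q = lamperti_kernel \<alpha> \<beta> \<gamma>"
  have "p > 0"
    using p(1) by (rule prime_gt_0_nat)
  have "degree Q \<le> 1" and coeff_Q: "degree (coeff Q n) \<le> 1" for n
    unfolding Q_def lamperti_kernel_def bimonom_def
    by (auto simp: coeff_monom intro!: degree_add_le degree_monom_le order.trans[OF degree_monom_le])
  then have "degree (Q ^ e) \<le> e" and "degree (coeff (Q ^ e) n) \<le> e" for e n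
    using order.trans[OF degree_power_le[of Q e] mult_le_mono1[of "degree Q" 1 e]]
      degree_coeff_power_le[of Q 1 e n] by auto
  then have bounds: "degree (Q ^ e) < p" "degree (coeff (Q ^ e) n) < p" if "e < p" for e n
    using that by (metis le_less_trans)+
  \<comment> \<open>\<open>R a b\<close> collects over \<open>e < p\<close> the coefficient of
    \<open>x^a y^b\<close> in \<open>Q^e\<close> as the coefficient of \<open>t^e\<close>; it does
    not depend on \<open>u\<close> and \<open>v\<close>.\<close>
  define R where "R a b = (\<Sum>e<p. Polynomial.monom (coeff (coeff (Q ^ e) b) a) e)" for a b
  have "?L (fps_X ^ a * u ^ p) (fps_X ^ b * v ^ p) = fps_of_poly (R a b) * ?L u v ^ p"
    if ab: "a < p" "b < p" for a b u v
  proof (rule fps_ext)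
    fix i
    define i' e where "i' = i div p" and "e = i mod p"
    have i: "i = i' * p + e" and "e < p"
      using \<open>p > 0\<close> by (simp_all add: i'_def e_def)
    have "Q ^ i = (Q ^ i') ^ p * Q ^ e"
      by (simp add: i power_add power_mult)
    then have "fps_nth (?L (fps_X ^ a * u ^ p) (fps_X ^ b * v ^ p)) i =
        coeff (coeff (Q ^ e) b) a * fps_nth (?L u v) i' ^ p"
      using bipoly_pairing_frobenius[OF p ab bounds[OF \<open>e < p\<close>], of u v "Q ^ i'"]
      by (simp add: fps_nth_lamperti_product Q_def)
    moreover have "fps_nth (fps_of_poly (R a b) * ?L u v ^ p) i =
        (\<Sum>s<p. if s = e then coeff (coeff (Q ^ s) b) a * fps_nth (?L u v) i' ^ p else 0)"
      unfolding R_def fps_of_poly_sum fps_of_poly_monom sum_distrib_right fps_sum_nth mult.assoc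
        fps_mult_left_const_nth
      by (intro sum.cong refl) (auto simp: fps_nth_X_power_mult_power_char[OF p] i'_def e_def)
    ultimately show "fps_nth (?L (fps_X ^ a * u ^ p) (fps_X ^ b * v ^ p)) i =
        fps_nth (fps_of_poly (R a b) * ?L u v ^ p) i"
      using \<open>e < p\<close> by simp
  qed
  then show ?thesis
    by blast
qed

text \<open>The products of all \<open>w i\<close> with all \<open>w' j\<close> form a polynomial
  system: bilinearity expands such a product, and the Frobenius rule sends each term back to a
  \<open>p\<close>-th power of another product in the family.\<close>

lemma annihilator_of_lamperti_product:
  fixes w :: "'i \<Rightarrow> 'k::field fps" and w' :: "'j \<Rightarrow> 'k fps"
  assumes p: "prime p" "p = CHAR('k)" and "I \<noteq> {}" and "I' \<noteq> {}"
    and w: "frobenius_system p I w" and w': "frobenius_system p I' w'"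
    and f: "f = (\<Sum>i\<in>I. fps_const (c i) * w i)" and g: "g = (\<Sum>j\<in>I'. fps_const (c' j) * w' j)"
  shows "\<exists>A. A \<noteq> 0 \<and> eval_series A (lamperti_product \<alpha> \<beta> \<gamma> f g) = 0 \<and>
    degree A \<le> p ^ (card I * card I') - 1"
proof -
  let ?L = "lamperti_product \<alpha> \<beta> \<gamma>"
  have fin: "finite I" "finite I'"
    using w w' by (simp_all add: frobenius_system_def)
  obtain R where R: "\<forall>a<p. \<forall>b<p. \<forall>u v.
      ?L (fps_X ^ a * u ^ p) (fps_X ^ b * v ^ p) = fps_of_poly (R a b) * ?L u v ^ p"
    using lamperti_product_frobenius[OF p] by blast
  have "\<forall>i\<in>I. \<exists>A. w i = (\<Sum>r<p. \<Sum>k\<in>I. fps_const (A r k) * (fps_X ^ r * w k ^ p))"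
    using w unfolding frobenius_system_def by (rule conjunct2)
  from bchoice[OF this] obtain A where A: "\<And>i. i \<in> I \<Longrightarrow>
      w i = (\<Sum>r<p. \<Sum>k\<in>I. fps_const (A i r k) * (fps_X ^ r * w k ^ p))"
    by blast
  have "\<forall>j\<in>I'. \<exists>A. w' j = (\<Sum>r<p. \<Sum>l\<in>I'. fps_const (A r l) * (fps_X ^ r * w' l ^ p))"
    using w' unfolding frobenius_system_def by (rule conjunct2)
  from bchoice[OF this] obtain A' where A': "\<And>j. j \<in> I' \<Longrightarrow>
      w' j = (\<Sum>r<p. \<Sum>l\<in>I'. fps_const (A' j r l) * (fps_X ^ r * w' l ^ p))"
    by blast
  define W where "W t = ?L (w (fst t)) (w' (snd t))" for t
  define B where "B t t' = (\<Sum>r<p. \<Sum>s<p.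
    [:A (fst t) r (fst t') * A' (snd t) s (snd t'):] * R r s)" for t t'
  have "W t = (\<Sum>t'\<in>I \<times> I'. fps_of_poly (B t t') * W t' ^ p)" if t_mem: "t \<in> I \<times> I'" for t
  proof -
    obtain i j where t: "t = (i, j)" "i \<in> I" "j \<in> I'"
      using t_mem by blast
    define S where "S = {..<p} \<times> I"
    define S' where "S' = {..<p} \<times> I'"
    have wi: "w i = (\<Sum>x\<in>S. fps_const (A i (fst x) (snd x)) * (fps_X ^ fst x * w (snd x) ^ p))"
      by (subst A[OF t(2)]) (simp add: S_def sum.cartesian_product case_prod_beta)
    have wj: "w' j = (\<Sum>y\<in>S'. fps_const (A' j (fst y) (snd y)) * (fps_X ^ fst y * w' (snd y) ^ p))"
      by (subst A'[OF t(3)]) (simp add: S'_def sum.cartesian_product case_prod_beta)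
    have "W t = (\<Sum>x\<in>S. fps_const (A i (fst x) (snd x)) * (\<Sum>y\<in>S'. fps_const (A' j (fst y) (snd y)) *
        ?L (fps_X ^ fst x * w (snd x) ^ p) (fps_X ^ fst y * w' (snd y) ^ p)))"
      unfolding W_def t fst_conv snd_conv
      by (subst wi, subst wj, subst lamperti_product_sum_left) (simp only: lamperti_product_sum_right)
    also have "\<dots> = (\<Sum>x\<in>S. \<Sum>y\<in>S'. fps_of_poly ([:A i (fst x) (snd x) * A' j (fst y) (snd y):] *
        R (fst x) (fst y)) * W (snd x, snd y) ^ p)"
      unfolding sum_distrib_left
      by (intro sum.cong refl) (auto simp: R S_def S'_def W_def fps_of_poly_mult fps_of_poly_const
          mult.assoc simp flip: fps_const_mult simp del: mult_pCons_left)
    also have "\<dots> = (\<Sum>r<p. \<Sum>k\<in>I. \<Sum>s<p. \<Sum>l\<in>I'. fps_of_poly ([:A i r k * A' j s l:] * R r s) *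
        W (k, l) ^ p)"
      by (simp only: S_def S'_def sum.cartesian_product' fst_conv snd_conv)
    also have "\<dots> = (\<Sum>r<p. \<Sum>k\<in>I. \<Sum>l\<in>I'. \<Sum>s<p. fps_of_poly ([:A i r k * A' j s l:] * R r s) *
        W (k, l) ^ p)"
      by (rule sum.cong[OF refl], rule sum.cong[OF refl], rule sum.swap)
    also have "\<dots> = (\<Sum>k\<in>I. \<Sum>r<p. \<Sum>l\<in>I'. \<Sum>s<p. fps_of_poly ([:A i r k * A' j s l:] * R r s) *
        W (k, l) ^ p)"
      by (rule sum.swap)
    also have "\<dots> = (\<Sum>k\<in>I. \<Sum>l\<in>I'. \<Sum>r<p. \<Sum>s<p. fps_of_poly ([:A i r k * A' j s l:] * R r s) *
        W (k, l) ^ p)"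
      by (rule sum.cong[OF refl], rule sum.swap)
    also have "\<dots> = (\<Sum>t'\<in>I \<times> I'. fps_of_poly (B t t') * W t' ^ p)"
      by (simp only: B_def t fst_conv snd_conv fps_of_poly_sum sum_distrib_right
          sum.cartesian_product')
    finally show ?thesis .
  qed
  moreover have "?L f g = (\<Sum>t\<in>I \<times> I'. fps_of_poly [:c (fst t) * c' (snd t):] * W t)"
    unfolding f g lamperti_product_sum_left unfolding lamperti_product_sum_right
    by (simp add: W_def sum.cartesian_product' sum_distrib_left fps_of_poly_const mult.assoc
        flip: fps_const_mult)
  moreover have "I \<times> I' \<noteq> {}" "finite (I \<times> I')"
    using assms fin by auto
  ultimately show ?thesis
    using annihilator_of_polynomial_system[OF p, of "I \<times> I'" W B "?L f g"
        "\<lambda>t. [:c (fst t) * c' (snd t):]"]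
    by (simp add: card_cartesian_product)
qed

section \<open>The Hadamard and Hurwitz products as special cases\<close>

lemma hadamard_product_eq_lamperti:
  "hadamard_product f g = lamperti_product 0 1 0 f g"
proof (rule fps_ext)
  fix i
  \<comment> \<open>A positive \<open>j\<close> or \<open>l\<close> brings in a factor 0, while
    \<open>0 ^ 0 = 1\<close> keeps the triple \<open>(0, i, 0)\<close>.\<close>
  have "fps_nth (lamperti_product 0 1 0 f g) i = (\<Sum>(j, m, l) \<in> {(0, i, 0)}.
      of_nat (fact i div (fact j * fact m * fact l)) * 0 ^ j * 1 ^ m * 0 ^ l
        * fps_nth f (j + m) * fps_nth g (l + m))"
    unfolding lamperti_product_def fps_nth_Abs_fps
    by (rule sum.mono_neutral_right) (auto intro: finite_subset[of _ "{..i} \<times> {..i} \<times> {..i}"])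
  then show "fps_nth (hadamard_product f g) i = fps_nth (lamperti_product 0 1 0 f g) i"
    by (simp add: hadamard_product_def)
qed

lemma hurwitz_product_eq_lamperti:
  "hurwitz_product f g = lamperti_product 1 0 1 f g"
proof (rule fps_ext)
  fix i
  \<comment> \<open>The middle parameter 0 leaves only \<open>m = 0\<close>, where the multinomial
    coefficient is a binomial one.\<close>
  have "fps_nth (lamperti_product 1 0 1 f g) i = (\<Sum>(j, m, l) \<in> (\<lambda>j. (j, 0, i - j)) ` {0..i}.
      of_nat (fact i div (fact j * fact m * fact l)) * 1 ^ j * 0 ^ m * 1 ^ l
        * fps_nth f (j + m) * fps_nth g (l + m))"
    unfolding lamperti_product_def fps_nth_Abs_fps
    by (rule sum.mono_neutral_right)
      (auto simp: image_iff intro: finite_subset[of _ "{..i} \<times> {..i} \<times> {..i}"])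
  also have "\<dots> = (\<Sum>j=0..i. of_nat (i choose j) * fps_nth f j * fps_nth g (i - j))"
    by (subst sum.reindex) (auto intro!: inj_onI sum.cong simp: binomial_fact')
  finally show "fps_nth (hurwitz_product f g) i = fps_nth (lamperti_product 1 0 1 f g) i"
    by (simp add: hurwitz_product_def)
qed

subsection \<open>Degrees of algebraic series\<close>

context
begin

interpretation laurent: field "laurent_ring :: 'k::field fls ring"
  by (rule field_from_type_algebra)

lemma laurent_ring_simps [simp]:
  "carrier laurent_ring = UNIV"
  "x \<otimes>\<^bsub>laurent_ring\<^esub> y = x * y"
  "x \<oplus>\<^bsub>laurent_ring\<^esub> y = x + y"
  "\<one>\<^bsub>laurent_ring\<^esub> = 1"
  "\<zero>\<^bsub>laurent_ring\<^esub> = 0"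
  by (simp_all add: ring_of_type_algebra_def)

lemma laurent_ring_uminus [simp]: "\<ominus>\<^bsub>laurent_ring\<^esub> x = - x"
  for x :: "'k::field fls"
  by (rule laurent.minus_equality) simp_all

lemma laurent_ring_inv: "x \<noteq> 0 \<Longrightarrow> inv\<^bsub>laurent_ring\<^esub> x = inverse x"
  for x :: "'k::field fls"
  by (rule laurent.comm_inv_char) simp_all

lemma laurent_ring_power [simp]: "x [^]\<^bsub>laurent_ring\<^esub> n = x ^ n"
  for x :: "'k::field fls" and n :: nat
  by (induction n) (simp_all add: mult.commute)

definition fls_of_poly :: "'k::field poly \<Rightarrow> 'k fls" where
  "fls_of_poly a = fps_to_fls (fps_of_poly a)"

lemma fls_of_poly_simps [simp]:
  "fls_of_poly 0 = 0"
  "fls_of_poly 1 = 1"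
  "fls_of_poly (a + b) = fls_of_poly a + fls_of_poly b"
  "fls_of_poly (a * b) = fls_of_poly a * fls_of_poly b"
  "fls_of_poly (- a) = - fls_of_poly a"
  by (simp_all add: fls_of_poly_def fps_of_poly_add fps_of_poly_mult fls_times_fps_to_fls
      fps_of_poly_uminus fps_to_fls_uminus)

lemma fls_of_poly_eq_0_iff [simp]: "fls_of_poly a = 0 \<longleftrightarrow> a = 0"
  using fps_of_poly_eq_iff[of a 0] by (simp add: fls_of_poly_def)

lemma rational_functions_altdef:
  "rational_functions = {fls_of_poly a / fls_of_poly b | a b. b \<noteq> 0}"
  by (simp add: rational_functions_def fls_of_poly_def)

lemma fls_of_poly_in_rational_functions: "fls_of_poly a \<in> rational_functions"
  unfolding rational_functions_altdef by (intro CollectI exI[of _ a] exI[of _ 1]) simp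

lemma subfield_rational_functions: "subfield rational_functions (laurent_ring :: 'k::field fls ring)"
proof (rule laurent.subfieldI')
  have mem: "fls_of_poly a / fls_of_poly b \<in> rational_functions" if "b \<noteq> 0" for a b :: "'k poly"
    using that unfolding rational_functions_altdef by blast
  show "subring rational_functions (laurent_ring :: 'k fls ring)"
  proof (rule laurent.subringI)
    show "\<one>\<^bsub>laurent_ring\<^esub> \<in> (rational_functions :: 'k fls set)"
      using fls_of_poly_in_rational_functions[of 1] by simp
    fix x :: "'k fls"
    assume "x \<in> rational_functions"
    then obtain a b where x: "x = fls_of_poly a / fls_of_poly b" "b \<noteq> 0"
      unfolding rational_functions_altdef by blast
    then show "\<ominus>\<^bsub>laurent_ring\<^esub> x \<in> rational_functions"
      using mem[of b "- a"] by simp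
    fix y :: "'k fls"
    assume "y \<in> rational_functions"
    then obtain c d where y: "y = fls_of_poly c / fls_of_poly d" "d \<noteq> 0"
      unfolding rational_functions_altdef by blast
    show "x \<otimes>\<^bsub>laurent_ring\<^esub> y \<in> rational_functions"
      using x y mem[of "b * d" "a * c"] by simp
    show "x \<oplus>\<^bsub>laurent_ring\<^esub> y \<in> rational_functions"
      using x y mem[of "b * d" "a * d + c * b"] by (simp add: add_frac_eq)
  qed simp
  fix x :: "'k fls"
  assume "x \<in> rational_functions - {\<zero>\<^bsub>laurent_ring\<^esub>}"
  then obtain a b where x: "x = fls_of_poly a / fls_of_poly b" "b \<noteq> 0" "x \<noteq> 0"
    unfolding rational_functions_altdef by auto
  then show "inv\<^bsub>laurent_ring\<^esub> x \<in> rational_functions"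
    using mem[of a b] by (auto simp: laurent_ring_inv)
qed

text \<open>List polynomials carry the leading coefficient first, so the head of
  \<open>c # q\<close> belongs to the power \<open>length q\<close> and denominators are cleared one
  head at a time. Vanishing from \<open>length q\<close> on expresses the degree bound uniformly,
  including the empty list.\<close>

lemma clear_denominators:
  fixes f :: "'k::field fps"
  assumes "set q \<subseteq> rational_functions"
  shows "\<exists>b B. b \<noteq> 0 \<and>
    fls_of_poly b * laurent.eval q (fps_to_fls f) = fps_to_fls (eval_series B f) \<and>
    (\<forall>i\<ge>length q. coeff B i = 0) \<and> (q \<noteq> [] \<longrightarrow> hd q \<noteq> 0 \<longrightarrow> B \<noteq> 0)"
  using assms
proof (induction q)
  case Nil
  show ?case
    by (rule exI[of _ 1], rule exI[of _ 0]) simp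
next
  case (Cons c q)
  then obtain b B where b: "b \<noteq> 0"
    and B: "fls_of_poly b * laurent.eval q (fps_to_fls f) = fps_to_fls (eval_series B f)"
    and B0: "\<And>i. i \<ge> length q \<Longrightarrow> coeff B i = 0"
    by auto
  obtain u v where c: "c = fls_of_poly u / fls_of_poly v" and v: "v \<noteq> 0"
    using Cons.prems unfolding rational_functions_altdef by auto
  define B' where "B' = smult v B + Polynomial.monom (u * b) (length q)"
  have "fls_of_poly (v * b) * laurent.eval (c # q) (fps_to_fls f) =
      fls_of_poly v * c * fls_of_poly b * fps_to_fls f ^ length q +
      fls_of_poly v * (fls_of_poly b * laurent.eval q (fps_to_fls f))"
    by (simp add: algebra_simps)
  also have "fls_of_poly v * c = fls_of_poly u"
    using v by (simp add: c)
  finally have "fls_of_poly (v * b) * laurent.eval (c # q) (fps_to_fls f) =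
      fps_to_fls (eval_series B' f)"
    unfolding B by (simp add: B'_def eval_series_monom fls_of_poly_def fps_of_poly_mult
        fls_times_fps_to_fls fps_to_fls_power)
  moreover have "\<forall>i\<ge>length (c # q). coeff B' i = 0"
    using B0 by (simp add: B'_def)
  moreover have "coeff B' (length q) = u * b"
    using B0[of "length q"] by (simp add: B'_def)
  then have "c \<noteq> 0 \<Longrightarrow> B' \<noteq> 0"
    using b by (auto simp: c)
  ultimately show ?case
    using b v by (intro exI[of _ "v * b"] exI[of _ B']) auto
qed

text \<open>Since \<open>f\<close> is algebraic, the ring \<open>k(t)[f]\<close> is already a field
  and so equals the generated field; its dimension is the degree of the minimal polynomial, one less
  than the length of the coefficient list.\<close>

lemma series_degree_eq_degree_Irr:
  assumes "algebraic_series f"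
  shows "series_degree f = length (laurent.Irr rational_functions (fps_to_fls f)) - 1"
proof -
  let ?K = "rational_functions :: 'a fls set" and ?x = "fps_to_fls f"
  have alg: "(laurent.algebraic over ?K) ?x"
    using assms by (simp add: algebraic_series_def)
  have ext: "subfield (laurent.simple_extension ?K ?x) laurent_ring"
    by (rule iffD2[OF laurent.simple_extension_is_subfield[OF subfield_rational_functions] alg]) simp
  have ring_K: "subring ?K laurent_ring"
    using subfield_rational_functions by (rule subfieldE)
  have "series_field f = laurent.simple_extension ?K ?x"
    unfolding series_field_def
  proof (rule laurent.generate_fieldI[symmetric])
    show "insert ?x ?K \<subseteq> laurent.simple_extension ?K ?x"
      using laurent.simple_extension_mem[OF ring_K] laurent.simple_extension_incl[of ?K ?x] by simp
    fix E assume "subfield E laurent_ring" "insert ?x ?K \<subseteq> E"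
    then show "laurent.simple_extension ?K ?x \<subseteq> E"
      using laurent.simple_extension_subring_incl[of E ?K ?x] subfieldE(1) by auto
  qed (use ext in simp_all)
  then show ?thesis
    unfolding series_degree_def
    using laurent.simple_extension_dim[OF subfield_rational_functions _ alg] by simp
qed

lemma annihilator_of_algebraic_series:
  assumes "algebraic_series f"
  shows "\<exists>B. B \<noteq> 0 \<and> eval_series B f = 0 \<and> degree B \<le> series_degree f"
proof -
  define q where "q = laurent.Irr rational_functions (fps_to_fls f)"
  have alg: "(laurent.algebraic over rational_functions) (fps_to_fls f)"
    using assms by (simp add: algebraic_series_def)
  note Irr = laurent.IrrE[OF subfield_rational_functions _ alg, folded q_def, simplified]
  have "q \<noteq> []"
    using Irr(2) laurent.pirreducibleE(1) by (auto simp: ring_irreducible_def univ_poly_zero)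
  moreover have "set q \<subseteq> rational_functions" "hd q \<noteq> 0"
    using Irr(1,3) by (auto simp: univ_poly_def polynomial_def)
  ultimately obtain b B where "b \<noteq> 0" "B \<noteq> 0"
    "fls_of_poly b * laurent.eval q (fps_to_fls f) = fps_to_fls (eval_series B f)"
    "\<And>i. i \<ge> length q \<Longrightarrow> coeff B i = 0"
    using clear_denominators[of q f] by auto
  moreover from this(4) have "degree B \<le> length q - 1"
    by (intro degree_le) auto
  ultimately show ?thesis
    using Irr(4) series_degree_eq_degree_Irr[OF assms] by (intro exI[of _ B]) (auto simp: q_def)
qed

lemma eval_map_rev_coeffs:
  "laurent.eval (map fls_of_poly (rev (coeffs A))) (fps_to_fls f) = fps_to_fls (eval_series A f)"
proof (induction A)
  case (pCons a A)
  then have "coeffs (pCons a A) = a # coeffs A"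
    by (auto simp: cCons_def)
  then show ?case
    using pCons.IH laurent.eval_append_aux[of "map fls_of_poly (rev (coeffs A))" "fls_of_poly a" "fps_to_fls f"]
    by (simp add: fls_times_fps_to_fls mult.commute add.commute flip: fls_of_poly_def)
qed simp

text \<open>Read over \<open>k(t)\<close>, the annihilator is a nonzero multiple of the minimal
  polynomial, whose degree is therefore at most \<open>degree A\<close>.\<close>

lemma algebraic_series_of_annihilator:
  assumes "A \<noteq> 0" and "eval_series A f = 0" and "degree A \<le> n"
  shows "algebraic_series f \<and> series_degree f \<le> n"
proof -
  let ?K = "rational_functions :: 'a fls set" and ?x = "fps_to_fls f"
  define q where "q = map fls_of_poly (rev (coeffs A))"
  have "q \<noteq> []" and len: "length q = Suc (degree A)"
    using assms(1) by (simp_all add: q_def length_coeffs_degree)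
  have "hd q = fls_of_poly (lead_coeff A)"
    using assms(1) by (simp add: q_def hd_map hd_rev last_coeffs_eq_coeff_degree)
  then have q: "q \<in> carrier (univ_poly laurent_ring ?K)"
    using assms(1) fls_of_poly_in_rational_functions
    by (auto simp: univ_poly_def polynomial_def q_def)
  have "laurent.eval q ?x = 0"
    using assms(2) by (simp add: q_def eval_map_rev_coeffs)
  then have alg: "(laurent.algebraic over ?K) ?x"
    using laurent.algebraicI[OF q \<open>q \<noteq> []\<close>] by simp
  then have "algebraic_series f"
    by (simp add: algebraic_series_def)
  moreover have "length (laurent.Irr ?K ?x) - 1 \<le> length q - 1"
  proof (rule laurent.pdivides_imp_degree_le)
    show "subring ?K laurent_ring"
      using subfield_rational_functions by (rule subfieldE)
    show "laurent.Irr ?K ?x \<in> carrier (univ_poly laurent_ring ?K)"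
      by (rule laurent.IrrE(1)[OF subfield_rational_functions _ alg]) simp
    show "laurent.Irr ?K ?x pdivides\<^bsub>laurent_ring\<^esub> q"
      by (rule laurent.Irr_minimal[OF subfield_rational_functions _ alg q])
        (simp_all add: \<open>laurent.eval q ?x = 0\<close>)
  qed fact+
  ultimately show ?thesis
    using series_degree_eq_degree_Irr[of f] len assms(3) by auto
qed

end

section \<open>Assembling the bound from degree and height\<close>

lemma frobenius_system_of_algebraic_series:
  fixes f :: "'k::field fps"
  assumes p: "prime p" "p = CHAR('k)" and "algebraic_series f"
  defines "I \<equiv> {..series_height f} \<times> {..series_degree f}"
  obtains w c where "frobenius_system p I w" "f = (\<Sum>i\<in>I. fps_const (c i) * w i)"
proof -
  obtain B where B: "B \<noteq> 0" "eval_series B f = 0" "degree B \<le> series_degree f"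
    using annihilator_of_algebraic_series[OF assms(3)] by blast
  \<comment> \<open>Existence of some annihilator is what gives the \<open>LEAST\<close> in
    \<open>series_height\<close> its meaning. Its minimiser \<open>A\<close> may differ from
    \<open>B\<close>, so \<open>M\<close> is taken to satisfy both bounds.\<close>
  then have "\<exists>n A. A \<noteq> 0 \<and> eval_series A f = 0 \<and> t_degree A = n"
    by blast
  from LeastI_ex[OF this] obtain A where
    A: "A \<noteq> 0" "eval_series A f = 0" "t_degree A = series_height f"
    unfolding series_height_def by blast
  have "degree (coeff A i) \<le> series_height f" for i
    using degree_coeff_le_t_degree[of A i] A(3) by simp
  from minimal_annihilator_exists[OF A(1,2) this B] obtain M where
    M: "M \<noteq> 0" "eval_series M f = 0" "degree M \<le> series_degree f"
      "\<And>i. degree (coeff M i) \<le> series_height f"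
      "\<And>C. C \<noteq> 0 \<Longrightarrow> eval_series C f = 0 \<Longrightarrow> degree M \<le> degree C"
    by blast
  have "eval_series (pderiv M) f \<noteq> 0"
    using minimal_annihilator_separable[OF p M(1,2,5)] .
  then show ?thesis
    using frobenius_system_of_algebraic[OF p M(2) _ M(3,4)] that unfolding I_def by blast
qed

theorem theorem6p3:
  fixes f g :: "'k::field fps" and p d d' h h' N :: nat
  assumes "p = CHAR('k)" and "p > 0"
    and "algebraic_series f" and "algebraic_series g"
    and "d = series_degree f" and "d' = series_degree g"
    and "h = series_height f" and "h' = series_height g"
    and "N = (d + 1) * (d' + 1) * (h + 1) * (h' + 1)"
  shows "(\<forall>\<alpha> \<beta> \<gamma>. algebraic_series (lamperti_product \<alpha> \<beta> \<gamma> f g)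
            \<and> series_degree (lamperti_product \<alpha> \<beta> \<gamma> f g) \<le> p ^ N - 1)
       \<and> (algebraic_series (hadamard_product f g)
            \<and> series_degree (hadamard_product f g) \<le> p ^ N - 1)
       \<and> (algebraic_series (hurwitz_product f g)
            \<and> series_degree (hurwitz_product f g) \<le> p ^ N - 1)"
proof -
  have p: "prime p" "p = CHAR('k)"
    using assms(1,2) prime_CHAR_semidom by auto
  define I where "I = {..h} \<times> {..d}"
  define I' where "I' = {..h'} \<times> {..d'}"
  obtain w c where w: "frobenius_system p I w" and f: "f = (\<Sum>i\<in>I. fps_const (c i) * w i)"
    using frobenius_system_of_algebraic_series[OF p assms(3)] assms(5,7) unfolding I_def by metis
  obtain w' c' where w': "frobenius_system p I' w'" and g: "g = (\<Sum>i\<in>I'. fps_const (c' i) * w' i)"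
    using frobenius_system_of_algebraic_series[OF p assms(4)] assms(6,8) unfolding I'_def by metis
  have "card I = (h + 1) * (d + 1)" and "card I' = (h' + 1) * (d' + 1)"
    by (simp_all add: I_def I'_def card_cartesian_product)
  then have "card I * card I' = N"
    unfolding assms(9) by (simp only: mult_ac)
  moreover have "I \<noteq> {}" "I' \<noteq> {}"
    by (auto simp: I_def I'_def)
  ultimately have "\<exists>A. A \<noteq> 0 \<and> eval_series A (lamperti_product \<alpha> \<beta> \<gamma> f g) = 0 \<and> degree A \<le> p ^ N - 1"
    for \<alpha> \<beta> \<gamma>
    using annihilator_of_lamperti_product[OF p _ _ w w' f g] by simp
  then have "algebraic_series (lamperti_product \<alpha> \<beta> \<gamma> f g)
      \<and> series_degree (lamperti_product \<alpha> \<beta> \<gamma> f g) \<le> p ^ N - 1" for \<alpha> \<beta> \<gamma>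
    using algebraic_series_of_annihilator by blast
  then show ?thesis
    by (simp add: hadamard_product_eq_lamperti hurwitz_product_eq_lamperti)
qed

end
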